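(* Let $(M,g)$ be a Lorentzian manifold of dimension $n\ge 2$, let $\{V,-V\}$ be a smooth non-vanishing line element field on $M$ with $g(V,V)=-1$, let $f\colon M\to\mathbb R$ be a smooth function having $1$ as a regular value, and let $\tilde g=g+f\,V^\flat\otimes V^\flat$ be the resulting signature-type changing metric, with hypersurface of signature change $\mathcal H=\{q\in M:\tilde g|_q\text{ is degenerate}\}=f^{-1}(1)$. Let $q\in\mathcal H$. (i) If $\mathrm{Rad}_q\not\subseteq T_q\mathcal H$, then the restriction of $\tilde g$ to $T_q\mathcal H$ is positive definite; thus, if the radical is transverse to $\mathcal H$ at every point, the induced metric on $\mathcal H$ is Riemannian. (ii) If $\mathrm{Rad}_q\subseteq T_q\mathcal H$, then the restriction of $\tilde g$ to $T_q\mathcal H$ is degenerate and positive semi-definite, with signature $(0,+,\ldots,+)$ with $n-2$ plus signs.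
   Context: Lorentzian metrics have signature $(-,+,\ldots,+)$. A smooth non-vanishing line element field is a smooth assignment to each $p\in M$ of an unordered pair $\{V_p,-V_p\}$ of opposite nonzero tangent vectors. $V^\flat=g(V,\cdot)$ is taken with respect to $g$, so $V^\flat\otimes V^\flat$ is independent of the choice of sign. For $q\in\mathcal H$, $\mathrm{Rad}_q=\{w\in T_qM:\tilde g(w,\cdot)=0\}$ (a one-dimensional subspace of $T_qM$), and $T_q\mathcal H=\ker(df_q)$. *)

theory Defs
  imports "HOL-Analysis.Analysis" "HOL-Library.Function_Algebras"
begin

section \<open>Pointwise real vector space structure on functions\<close>

instantiation "fun" :: (type, real_vector) real_vector
begin

definition scaleR_fun_def: "scaleR r f = (\<lambda>x. r *\<^sub>R f x)"

instance
  by standard (auto simp: scaleR_fun_def fun_eq_iff algebra_simps)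

end

section \<open>Symmetric bilinear forms on subspaces\<close>

text \<open>Throughout, \<open>W\<close> is a subspace and only the values of \<open>b\<close> on \<open>W\<close> matter.\<close>

definition symmetric_bilinear_on :: "'v::real_vector set \<Rightarrow> ('v \<Rightarrow> 'v \<Rightarrow> real) \<Rightarrow> bool" where
  "symmetric_bilinear_on W b \<longleftrightarrow>
     (\<forall>u\<in>W. \<forall>v\<in>W. b u v = b v u) \<and>
     (\<forall>u\<in>W. \<forall>v\<in>W. \<forall>w\<in>W. b (u + v) w = b u w + b v w) \<and>
     (\<forall>r. \<forall>u\<in>W. \<forall>w\<in>W. b (r *\<^sub>R u) w = r * b u w)"

definition radical_on :: "'v::real_vector set \<Rightarrow> ('v \<Rightarrow> 'v \<Rightarrow> real) \<Rightarrow> 'v set" where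
  "radical_on W b = {w \<in> W. \<forall>u\<in>W. b w u = 0}"

definition degenerate_on :: "'v::real_vector set \<Rightarrow> ('v \<Rightarrow> 'v \<Rightarrow> real) \<Rightarrow> bool" where
  "degenerate_on W b \<longleftrightarrow> (\<exists>w \<in> radical_on W b. w \<noteq> 0)"

definition positive_definite_on :: "'v::real_vector set \<Rightarrow> ('v \<Rightarrow> 'v \<Rightarrow> real) \<Rightarrow> bool" where
  "positive_definite_on W b \<longleftrightarrow> (\<forall>w\<in>W. w \<noteq> 0 \<longrightarrow> b w w > 0)"

definition positive_semidefinite_on :: "'v::real_vector set \<Rightarrow> ('v \<Rightarrow> 'v \<Rightarrow> real) \<Rightarrow> bool" where
  "positive_semidefinite_on W b \<longleftrightarrow> (\<forall>w\<in>W. b w w \<ge> 0)"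

text \<open>\<open>has_signature W b k m l\<close>: in some orthogonal basis of \<open>W\<close>, the form \<open>b\<close> has \<open>k\<close> zero,
  \<open>m\<close> negative and \<open>l\<close> positive diagonal entries.\<close>

definition has_signature ::
    "'v::real_vector set \<Rightarrow> ('v \<Rightarrow> 'v \<Rightarrow> real) \<Rightarrow> nat \<Rightarrow> nat \<Rightarrow> nat \<Rightarrow> bool" where
  "has_signature W b k m l \<longleftrightarrow>
     (\<exists>E. finite E \<and> independent E \<and> span E = W \<and>
          (\<forall>x\<in>E. \<forall>y\<in>E. x \<noteq> y \<longrightarrow> b x y = 0) \<and>
          card {x\<in>E. b x x = 0} = k \<and>
          card {x\<in>E. b x x < 0} = m \<and>
          card {x\<in>E. b x x > 0} = l)"

section \<open>Smooth maps between open subsets of Euclidean spaces\<close>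

text \<open>\<open>S\<close> is meant to be open.\<close>

primrec Ck_on ::
    "nat \<Rightarrow> 'a::real_normed_vector set \<Rightarrow> ('a \<Rightarrow> 'b::real_normed_vector) \<Rightarrow> bool" where
  "Ck_on 0 S f \<longleftrightarrow> continuous_on S f"
| "Ck_on (Suc k) S f \<longleftrightarrow>
     (\<forall>x\<in>S. f differentiable (at x)) \<and>
     (\<forall>v. Ck_on k S (\<lambda>x. frechet_derivative f (at x) v))"

definition smooth_on ::
    "'a::real_normed_vector set \<Rightarrow> ('a \<Rightarrow> 'b::real_normed_vector) \<Rightarrow> bool" where
  "smooth_on S f \<longleftrightarrow> (\<forall>k. Ck_on k S f)"

section \<open>Smooth manifolds\<close>

text \<open>A chart is a pair of its domain and its coordinate map; the values of the coordinate map
  outside the domain are irrelevant.\<close>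

type_synonym ('m, 'e) chart = "'m set \<times> ('m \<Rightarrow> 'e)"

definition chart_inv :: "('m, 'e) chart \<Rightarrow> 'e \<Rightarrow> 'm" where
  "chart_inv c = inv_into (fst c) (snd c)"

definition charts_at :: "('m, 'e) chart set \<Rightarrow> 'm \<Rightarrow> ('m, 'e) chart set" where
  "charts_at A p = {c \<in> A. p \<in> fst c}"

definition is_chart :: "'m topology \<Rightarrow> ('m, 'e::euclidean_space) chart \<Rightarrow> bool" where
  "is_chart X c \<longleftrightarrow>
     openin X (fst c) \<and> open (snd c ` fst c) \<and>
     homeomorphic_map (subtopology X (fst c)) (top_of_set (snd c ` fst c)) (snd c)"

text \<open>The atlas need not be maximal.\<close>

definition smooth_manifold :: "'m topology \<Rightarrow> ('m, 'e::euclidean_space) chart set \<Rightarrow> bool" where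
  "smooth_manifold X A \<longleftrightarrow>
     Hausdorff_space X \<and> second_countable X \<and>
     (\<forall>c\<in>A. is_chart X c) \<and>
     (\<Union>c\<in>A. fst c) = topspace X \<and>
     (\<forall>c\<in>A. \<forall>d\<in>A. smooth_on (snd c ` (fst c \<inter> fst d)) (snd d \<circ> chart_inv c))"

definition smooth_function ::
    "('m, 'e::euclidean_space) chart set \<Rightarrow> ('m \<Rightarrow> real) \<Rightarrow> bool" where
  "smooth_function A f \<longleftrightarrow> (\<forall>c\<in>A. smooth_on (snd c ` fst c) (f \<circ> chart_inv c))"

definition smooth_map ::
    "'m topology \<Rightarrow> ('m, 'e::euclidean_space) chart set \<Rightarrow>
     'n topology \<Rightarrow> ('n, 'd::euclidean_space) chart set \<Rightarrow> ('m \<Rightarrow> 'n) \<Rightarrow> bool" where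
  "smooth_map X A Y B F \<longleftrightarrow>
     continuous_map X Y F \<and>
     (\<forall>c\<in>A. \<forall>d\<in>B. smooth_on (snd c ` (fst c \<inter> F -` fst d)) (snd d \<circ> F \<circ> chart_inv c))"

section \<open>Tangent vectors\<close>

text \<open>A tangent vector at \<open>p\<close> assigns to every chart around \<open>p\<close> its components in that chart,
  subject to the usual transformation law. It is extended by zero to all other pairs, so that
  equality and the vector space operations are those of functions.\<close>

type_synonym ('m, 'e) tangent_vector = "('m, 'e) chart \<Rightarrow> 'e"

definition tangent_space ::
    "('m, 'e::euclidean_space) chart set \<Rightarrow> 'm \<Rightarrow> ('m, 'e) tangent_vector set" where
  "tangent_space A p =
     {v. (\<forall>c. c \<notin> charts_at A p \<longrightarrow> v c = 0) \<and>
         (\<forall>c\<in>charts_at A p. \<forall>d\<in>charts_at A p.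
            v d = frechet_derivative (snd d \<circ> chart_inv c) (at (snd c p)) (v c))}"

text \<open>The tangent vector at \<open>p\<close> whose components in the chart \<open>c\<close> are \<open>a\<close>; for \<open>a\<close> in the
  standard basis these are the coordinate vectors of \<open>c\<close>.\<close>

definition coord_vector ::
    "('m, 'e::euclidean_space) chart set \<Rightarrow> ('m, 'e) chart \<Rightarrow> 'm \<Rightarrow> 'e \<Rightarrow> ('m, 'e) tangent_vector" where
  "coord_vector A c p a =
     (\<lambda>d. if d \<in> charts_at A p
          then frechet_derivative (snd d \<circ> chart_inv c) (at (snd c p)) a else 0)"

text \<open>In the next two definitions the choice of the chart around \<open>p\<close> is immaterial by the chain
  rule.\<close>

definition diff_function ::
    "('m, 'e::euclidean_space) chart set \<Rightarrow> ('m \<Rightarrow> real) \<Rightarrow> 'm \<Rightarrow> ('m, 'e) tangent_vector \<Rightarrow> real" where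
  "diff_function A f p v =
     (let c = (SOME c. c \<in> charts_at A p)
      in frechet_derivative (f \<circ> chart_inv c) (at (snd c p)) (v c))"

definition diff_map ::
    "('m, 'e::euclidean_space) chart set \<Rightarrow> ('n, 'd::euclidean_space) chart set \<Rightarrow> ('m \<Rightarrow> 'n) \<Rightarrow>
     'm \<Rightarrow> ('m, 'e) tangent_vector \<Rightarrow> ('n, 'd) tangent_vector" where
  "diff_map A B F p v =
     (let c = (SOME c. c \<in> charts_at A p)
      in (\<lambda>d. if d \<in> charts_at B (F p)
              then frechet_derivative (snd d \<circ> F \<circ> chart_inv c) (at (snd c p)) (v c) else 0))"

definition ker_diff ::
    "('m, 'e::euclidean_space) chart set \<Rightarrow> ('m \<Rightarrow> real) \<Rightarrow> 'm \<Rightarrow> ('m, 'e) tangent_vector set" where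
  "ker_diff A f p = {v \<in> tangent_space A p. diff_function A f p v = 0}"

definition regular_value ::
    "'m topology \<Rightarrow> ('m, 'e::euclidean_space) chart set \<Rightarrow> ('m \<Rightarrow> real) \<Rightarrow> real \<Rightarrow> bool" where
  "regular_value X A f y \<longleftrightarrow>
     (\<forall>p\<in>topspace X. f p = y \<longrightarrow> diff_function A f p ` tangent_space A p = UNIV)"

definition smooth_vector_field_on ::
    "('m, 'e::euclidean_space) chart set \<Rightarrow> 'm set \<Rightarrow> ('m \<Rightarrow> ('m, 'e) tangent_vector) \<Rightarrow> bool" where
  "smooth_vector_field_on A U Y \<longleftrightarrow>
     (\<forall>p\<in>U. Y p \<in> tangent_space A p) \<and>
     (\<forall>c\<in>A. smooth_on (snd c ` (fst c \<inter> U)) (\<lambda>x. Y (chart_inv c x) c))"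

section \<open>Metrics\<close>

type_synonym ('m, 'e) tensor_field =
  "'m \<Rightarrow> ('m, 'e) tangent_vector \<Rightarrow> ('m, 'e) tangent_vector \<Rightarrow> real"

definition smooth_symmetric_tensor ::
    "'m topology \<Rightarrow> ('m, 'e::euclidean_space) chart set \<Rightarrow> ('m, 'e) tensor_field \<Rightarrow> bool" where
  "smooth_symmetric_tensor X A h \<longleftrightarrow>
     (\<forall>p\<in>topspace X. symmetric_bilinear_on (tangent_space A p) (h p)) \<and>
     (\<forall>c\<in>A. \<forall>a b. smooth_on (snd c ` fst c)
        (\<lambda>x. h (chart_inv c x) (coord_vector A c (chart_inv c x) a)
                               (coord_vector A c (chart_inv c x) b)))"

definition riemannian_manifold ::
    "'m topology \<Rightarrow> ('m, 'e::euclidean_space) chart set \<Rightarrow> ('m, 'e) tensor_field \<Rightarrow> bool" where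
  "riemannian_manifold X A h \<longleftrightarrow>
     smooth_manifold X A \<and> smooth_symmetric_tensor X A h \<and>
     (\<forall>p\<in>topspace X. positive_definite_on (tangent_space A p) (h p))"

definition lorentzian_manifold ::
    "'m topology \<Rightarrow> ('m, 'e::euclidean_space) chart set \<Rightarrow> ('m, 'e) tensor_field \<Rightarrow> bool" where
  "lorentzian_manifold X A g \<longleftrightarrow>
     smooth_manifold X A \<and> smooth_symmetric_tensor X A g \<and>
     (\<forall>p\<in>topspace X. has_signature (tangent_space A p) (g p) 0 1 (DIM('e) - 1))"

definition pullback_tensor ::
    "('m, 'e::euclidean_space) chart set \<Rightarrow> ('n, 'd::euclidean_space) chart set \<Rightarrow> ('m \<Rightarrow> 'n) \<Rightarrow>
     ('n, 'd) tensor_field \<Rightarrow> ('m, 'e) tensor_field" where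
  "pullback_tensor A B F h = (\<lambda>p u v. h (F p) (diff_map A B F p u) (diff_map A B F p v))"

text \<open>\<open>B\<close> is an atlas which makes the subspace \<open>S\<close> of the manifold \<open>(X, A)\<close> a smoothly embedded
  submanifold of codimension one.\<close>

definition embedded_hypersurface ::
    "'m topology \<Rightarrow> ('m, 'e::euclidean_space) chart set \<Rightarrow> 'm set \<Rightarrow>
     ('m, 'h::euclidean_space) chart set \<Rightarrow> bool" where
  "embedded_hypersurface X A S B \<longleftrightarrow>
     S \<subseteq> topspace X \<and> DIM('h) + 1 = DIM('e) \<and>
     smooth_manifold (subtopology X S) B \<and>
     smooth_map (subtopology X S) B X A id \<and>
     (\<forall>p\<in>S. inj_on (diff_map B A id p) (tangent_space B p))"

section \<open>Line element fields and signature change\<close>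

definition smooth_line_element_field ::
    "'m topology \<Rightarrow> ('m, 'e::euclidean_space) chart set \<Rightarrow>
     ('m \<Rightarrow> ('m, 'e) tangent_vector set) \<Rightarrow> bool" where
  "smooth_line_element_field X A L \<longleftrightarrow>
     (\<forall>p\<in>topspace X. \<exists>v\<in>tangent_space A p. v \<noteq> 0 \<and> L p = {v, - v}) \<and>
     (\<forall>p\<in>topspace X. \<exists>U Y. openin X U \<and> p \<in> U \<and> smooth_vector_field_on A U Y \<and>
        (\<forall>x\<in>U. L x = {Y x, - Y x}))"

text \<open>The tensor field \<open>g + f V\<^sup>\<flat> \<otimes> V\<^sup>\<flat>\<close>, which does not depend on the sign of the
  representative \<open>V\<close> of the line element.\<close>

definition signature_changing_metric ::
    "('m, 'e) tensor_field \<Rightarrow> ('m \<Rightarrow> ('m, 'e) tangent_vector set) \<Rightarrow> ('m \<Rightarrow> real) \<Rightarrow>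
     ('m, 'e) tensor_field" where
  "signature_changing_metric g L f =
     (\<lambda>p u w. let V = (SOME V. V \<in> L p) in g p u w + f p * (g p V u * g p V w))"

definition degeneracy_locus ::
    "'m topology \<Rightarrow> ('m, 'e::euclidean_space) chart set \<Rightarrow> ('m, 'e) tensor_field \<Rightarrow> 'm set" where
  "degeneracy_locus X A h = {p \<in> topspace X. degenerate_on (tangent_space A p) (h p)}"

definition transverse_in :: "'v::real_vector set \<Rightarrow> 'v set \<Rightarrow> 'v set \<Rightarrow> bool" where
  "transverse_in T U W \<longleftrightarrow> {u + w | u w. u \<in> U \<and> w \<in> W} = T"

end

theory Submission
  imports Defs
begin

text \<open>Write \<open>h = g + f V\<^sup>\<flat> \<otimes> V\<^sup>\<flat>\<close>. Then \<open>h(V, u) = (1 - f) g(V, u)\<close>, and where \<open>f = 1\<close> the value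
  \<open>h(u, u)\<close> is that of \<open>g\<close> on the \<open>g\<close>-orthogonal projection of \<open>u\<close> to the complement of \<open>V\<close>, on which
  \<open>g\<close> is positive definite because \<open>V\<close> is timelike. So \<open>h\<close> degenerates exactly where \<open>f = 1\<close>; there it
  is positive semidefinite with radical the line through \<open>V\<close>. A hyperplane either misses this line,
  and then \<open>h\<close> is definite on it, or it is the sum of the line and a positive definite space of
  dimension \<open>n - 2\<close>.\<close>


section \<open>Linear algebra of symmetric bilinear forms\<close>

text \<open>Calling the induced metric Riemannian also claims that it is smooth in the charts of an
  arbitrary atlas that makes \<open>H\<close> an embedded hypersurface, so smoothness has to be
  carried through products, compositions and the differential of the inclusion; the calculus of
  \<open>Ck_on\<close> serves that. The obstacle is the choice \<open>SOME V. V \<in> L p\<close> in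
  \<open>signature_changing_metric\<close>: its sign may jump from point to point, so smoothness is
  checked locally, with a smooth field whose sign cancels in the product of the two factors. That 1
  is a regular value enters as df \<noteq> 0 on \<open>H\<close>: it makes the kernel of df a
  hyperplane, which fixes the number n - 2 of plus signs, and it turns transversality of radical and
  kernel into non-inclusion of the radical.\<close>

locale bilinear_subspace =
  fixes W :: "'v::real_vector set" and b :: "'v \<Rightarrow> 'v \<Rightarrow> real"
  assumes subspace: "subspace W" and bilinear: "symmetric_bilinear_on W b"
begin

lemma sym: "u \<in> W \<Longrightarrow> v \<in> W \<Longrightarrow> b u v = b v u"
  using bilinear unfolding symmetric_bilinear_on_def by blast

lemma add_left: "u \<in> W \<Longrightarrow> v \<in> W \<Longrightarrow> w \<in> W \<Longrightarrow> b (u + v) w = b u w + b v w"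
  using bilinear unfolding symmetric_bilinear_on_def by blast

lemma scale_left: "u \<in> W \<Longrightarrow> w \<in> W \<Longrightarrow> b (r *\<^sub>R u) w = r * b u w"
  using bilinear unfolding symmetric_bilinear_on_def by blast

lemma add_right: "u \<in> W \<Longrightarrow> v \<in> W \<Longrightarrow> w \<in> W \<Longrightarrow> b w (u + v) = b w u + b w v"
  by (metis add_left sym subspace subspace_add)

lemma scale_right: "u \<in> W \<Longrightarrow> w \<in> W \<Longrightarrow> b w (r *\<^sub>R u) = r * b w u"
  by (metis scale_left sym subspace subspace_scale)

lemma diff_left:
  assumes "u \<in> W" "v \<in> W" "w \<in> W" shows "b (u - v) w = b u w - b v w"
  using add_left[of "u - v" v w] subspace_diff[OF subspace, of u v] assms by simp

lemma diff_right: "u \<in> W \<Longrightarrow> v \<in> W \<Longrightarrow> w \<in> W \<Longrightarrow> b w (u - v) = b w u - b w v"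
  by (metis diff_left sym subspace subspace_diff)

lemma zero_left: "w \<in> W \<Longrightarrow> b 0 w = 0"
  using scale_left[of w w 0] by simp

lemma zero_right: "w \<in> W \<Longrightarrow> b w 0 = 0"
  using scale_right[of w w 0] by simp

lemma sum_scale_left:
  "finite I \<Longrightarrow> (\<And>i. i \<in> I \<Longrightarrow> x i \<in> W) \<Longrightarrow> w \<in> W \<Longrightarrow>
     b (\<Sum>i\<in>I. r i *\<^sub>R x i) w = (\<Sum>i\<in>I. r i * b (x i) w)"
  by (induction I rule: finite_induct)
    (auto simp: zero_left add_left scale_left subspace_sum[OF subspace] subspace_scale[OF subspace])

lemma sum_scale_right:
  "finite I \<Longrightarrow> (\<And>i. i \<in> I \<Longrightarrow> x i \<in> W) \<Longrightarrow> w \<in> W \<Longrightarrow>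
     b w (\<Sum>i\<in>I. r i *\<^sub>R x i) = (\<Sum>i\<in>I. r i * b w (x i))"
  by (induction I rule: finite_induct)
    (auto simp: zero_right add_right scale_right subspace_sum[OF subspace] subspace_scale[OF subspace])

lemma span_in: "E \<subseteq> W \<Longrightarrow> x \<in> span E \<Longrightarrow> x \<in> W"
  using span_minimal[OF _ subspace, of E] by blast

lemma orthogonal_coefficient:
  assumes E: "finite E" "E \<subseteq> W" "\<forall>x\<in>E. \<forall>y\<in>E. x \<noteq> y \<longrightarrow> b x y = 0" and e: "e \<in> E"
  shows "b (\<Sum>x\<in>E. r x *\<^sub>R x) e = r e * b e e"
proof -
  have "b (\<Sum>x\<in>E. r x *\<^sub>R x) e = (\<Sum>x\<in>E. r x * b x e)"
    using E e by (subst sum_scale_left) auto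
  also have "\<dots> = (\<Sum>x\<in>E. if x = e then r e * b e e else 0)"
    using E e by (intro sum.cong) auto
  finally show ?thesis using E e by simp
qed

text \<open>Orthogonality turns \<open>b u u\<close> into the sum of
  \<open>(r x)\<^sup>2 * b x x\<close>, and \<open>u \<noteq> 0\<close> forces a nonzero coefficient
  in whatever representation was picked.\<close>

lemma orthogonal_positive_definite:
  assumes E: "finite E" "E \<subseteq> W" "\<forall>x\<in>E. \<forall>y\<in>E. x \<noteq> y \<longrightarrow> b x y = 0"
    and pos: "\<forall>x\<in>E. b x x > 0"
  shows "positive_definite_on (span E) b"
  unfolding positive_definite_on_def
proof (intro ballI impI)
  fix u assume u: "u \<in> span E" "u \<noteq> 0"
  then obtain r where r: "u = (\<Sum>x\<in>E. r x *\<^sub>R x)" using span_finite[OF E(1)] by auto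
  have uW: "u \<in> W" using u E(2) span_in by blast
  have "b u u = (\<Sum>x\<in>E. r x * b u x)"
    using sum_scale_right[of E "\<lambda>x. x" u r] E uW unfolding r[symmetric] by auto
  also have "\<dots> = (\<Sum>x\<in>E. (r x)\<^sup>2 * b x x)"
    using orthogonal_coefficient[OF E, of _ r] unfolding r[symmetric]
    by (intro sum.cong) (auto simp: power2_eq_square)
  finally have eq: "b u u = (\<Sum>x\<in>E. (r x)\<^sup>2 * b x x)" .
  obtain e where e: "e \<in> E" "r e \<noteq> 0"
    using u(2) r by (metis (mono_tags, lifting) scaleR_zero_left sum.neutral)
  have "(\<Sum>x\<in>E. (r x)\<^sup>2 * b x x) > 0"
    using E(1) e pos by (intro sum_pos2[of E e]) (auto intro: less_imp_le)
  then show "b u u > 0" using eq by simp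
qed

text \<open>Gram-Schmidt. Vectors already in the span are dropped, which keeps the basis
  independent; definiteness gives \<open>b x x > 0\<close>, so that the projection coefficients can
  be formed.\<close>

lemma orthogonal_basis_of_span:
  assumes "finite S" "S \<subseteq> W" "positive_definite_on W b"
  shows "\<exists>E. finite E \<and> E \<subseteq> W \<and> independent E \<and> span E = span S \<and>
    (\<forall>x\<in>E. \<forall>y\<in>E. x \<noteq> y \<longrightarrow> b x y = 0)"
  using assms(1,2)
proof (induction S rule: finite_induct)
  case empty
  then show ?case by (intro exI[of _ "{}"]) (auto simp: independent_empty)
next
  case (insert a S)
  then obtain E where E: "finite E" "E \<subseteq> W" "independent E" "span E = span S"
    "\<forall>x\<in>E. \<forall>y\<in>E. x \<noteq> y \<longrightarrow> b x y = 0" by auto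
  have span_ins: "span (insert a S) = span (insert a E)"
    using E(4) by (simp add: span_insert)
  show ?case
  proof (cases "a \<in> span E")
    case True
    then have "span (insert a E) = span E" by (simp add: span_redundant)
    then show ?thesis using E span_ins by auto
  next
    case False
    have aW: "a \<in> W" using insert by auto
    have "0 \<notin> E" using E(3) dependent_zero by metis
    then have pos: "b x x > 0" if "x \<in> E" for x
      using that E(2) assms(3) unfolding positive_definite_on_def by (metis subsetD)
    define y where "y = (\<Sum>x\<in>E. (b a x / b x x) *\<^sub>R x)"
    have yE: "y \<in> span E" unfolding y_def by (intro span_sum span_scale span_base)
    have yW: "y \<in> W" using yE E(2) span_in by blast
    have orth: "b (a - y) e = 0" if e: "e \<in> E" for e
    proof -
      have "b y e = b a e / b e e * b e e"
        unfolding y_def using orthogonal_coefficient[OF E(1,2,5) e] .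
      then show ?thesis using pos[OF e] e E(2) aW yW by (subst diff_left) auto
    qed
    have ayW: "a - y \<in> W" using aW yW subspace_diff[OF subspace] by blast
    have orth': "b e (a - y) = 0" if "e \<in> E" for e
      using orth[OF that] sym[OF _ ayW, of e] that E(2) by auto
    have nin: "a - y \<notin> span E" using False yE
      by (metis diff_add_cancel span_add)
    have "a - (a - y) \<in> span E" using yE by simp
    then have "span (insert a E) = span (insert (a - y) E)" by (rule eq_span_insert_eq)
    moreover have "\<forall>x\<in>insert (a - y) E. \<forall>z\<in>insert (a - y) E. x \<noteq> z \<longrightarrow> b x z = 0"
      using orth orth' E(5) by auto
    moreover have "independent (insert (a - y) E)" using nin E(3) by (rule independent_insertI)
    ultimately show ?thesis using span_ins E(1,2) ayW
      by (intro exI[of _ "insert (a - y) E"]) auto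
  qed
qed

text \<open>If \<open>u\<close> is orthogonal to the timelike vector \<open>V\<close> and \<open>b u u \<le> 0\<close>, then \<open>b\<close> is negative
  semidefinite on the plane spanned by both, but this plane meets the positive hyperplane.\<close>

lemma timelike_complement_positive:
  assumes sig: "has_signature W b 0 1 l" and V: "V \<in> W" "b V V < 0"
    and u: "u \<in> W" "u \<noteq> 0" "b V u = 0"
  shows "b u u > 0"
proof (rule ccontr)
  assume neg: "\<not> b u u > 0"
  obtain E where E: "finite E" "independent E" "span E = W"
    "\<forall>x\<in>E. \<forall>y\<in>E. x \<noteq> y \<longrightarrow> b x y = 0"
    "card {x\<in>E. b x x = 0} = 0" "card {x\<in>E. b x x < 0} = 1"
    using sig unfolding has_signature_def by blast
  obtain e where e: "{x\<in>E. b x x < 0} = {e}" using E(6) by (auto simp: card_1_singleton_iff)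
  have "{x\<in>E. b x x = 0} = {}" using E(1,5) by auto
  then have pos: "\<forall>x\<in>E - {e}. b x x > 0" using e by (auto simp: set_eq_iff) (metis linorder_cases)
  have EW: "E - {e} \<subseteq> W" using E(3) span_superset by blast
  have pd: "positive_definite_on (span (E - {e})) b"
    using E(1,4) pos EW by (intro orthogonal_positive_definite) auto
  have "insert e (E - {e}) = E" using e by auto
  then have "W = span (insert e (E - {e}))" using E(3) by simp
  then obtain k l where k: "V - k *\<^sub>R e \<in> span (E - {e})" and l: "u - l *\<^sub>R e \<in> span (E - {e})"
    using V(1) u(1) span_breakdown_eq[of _ e "E - {e}"] by metis
  have pd': "b w w \<ge> 0" if "w \<in> span (E - {e})" for w
    using pd that EW unfolding positive_definite_on_def
    by (cases "w = 0") (auto simp: zero_left subspace subspace_0 less_imp_le)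
  \<comment> \<open>Modulo the positive hyperplane \<open>span (E - {e})\<close> the vectors
    \<open>V\<close> and \<open>u\<close> are \<open>k\<close> and \<open>l\<close> times
    \<open>e\<close>, so this combination cancels the \<open>e\<close> part and lies in that
    hyperplane.\<close>
  define w where "w = l *\<^sub>R V - k *\<^sub>R u"
  have "w = l *\<^sub>R (V - k *\<^sub>R e) - k *\<^sub>R (u - l *\<^sub>R e)" unfolding w_def by (simp add: algebra_simps)
  then have w: "w \<in> span (E - {e})" using k l by (simp add: span_diff span_scale)
  have uV: "b u V = 0" using u V sym by simp
  have in_W: "r *\<^sub>R V \<in> W" "r *\<^sub>R u \<in> W" for r using V u subspace subspace_scale by blast+
  have wW: "w \<in> W" unfolding w_def using in_W subspace_diff[OF subspace] by blast
  have "b w w = l * b V w - k * b u w"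
    using diff_left[OF in_W wW] scale_left[OF V(1) wW] scale_left[OF u(1) wW] by (simp add: w_def)
  also have "b V w = l * b V V"
    using diff_right[OF in_W V(1)] scale_right[OF V(1) V(1)] scale_right[OF u(1) V(1)] u(3)
    by (simp add: w_def)
  also have "b u w = - k * b u u"
    using diff_right[OF in_W u(1)] scale_right[OF V(1) u(1)] scale_right[OF u(1) u(1)] uV
    by (simp add: w_def)
  finally have "b w w = l\<^sup>2 * b V V + k\<^sup>2 * b u u" by (simp add: power2_eq_square)
  moreover have "l\<^sup>2 * b V V \<le> 0" "k\<^sup>2 * b u u \<le> 0"
    using V(2) neg by (auto intro: mult_nonneg_nonpos)
  \<comment> \<open>Both summands are nonpositive while \<open>b w w\<close> is nonnegative, so the
    one with \<open>b V V < 0\<close> must vanish. Hence \<open>l = 0\<close>, and \<open>u\<close>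
    itself lies in the hyperplane where \<open>b\<close> is positive definite.\<close>
  ultimately have "b w w \<le> 0" "b w w \<ge> 0 \<Longrightarrow> l\<^sup>2 * b V V = 0" by linarith+
  with pd'[OF w] V(2) have "l = 0" by auto
  then have "u \<in> span (E - {e})" using l by simp
  then have "b u u > 0" using pd u unfolding positive_definite_on_def by blast
  with neg show False by simp
qed

end

section \<open>The modified form at a single point\<close>

locale unit_timelike_vector = bilinear_subspace W b
  for W :: "'v::real_vector set" and b :: "'v \<Rightarrow> 'v \<Rightarrow> real" +
  fixes V :: 'v and l :: nat
  assumes signature: "has_signature W b 0 1 l" and V_in: "V \<in> W" and V_unit: "b V V = - 1"
begin

text \<open>The pointwise model of \<open>signature_changing_metric\<close>, with \<open>t\<close>
  in place of \<open>f p\<close>. The normalisation \<open>b V V = - 1\<close> is what puts the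
  degeneracy at \<open>t = 1\<close>.\<close>

definition change :: "real \<Rightarrow> 'v \<Rightarrow> 'v \<Rightarrow> real" where
  "change t u w = b u w + t * (b V u * b V w)"

lemma bilinear_change: "symmetric_bilinear_on W (change t)"
  unfolding symmetric_bilinear_on_def change_def
  using V_in by (auto simp: add_left scale_left add_right scale_right algebra_simps sym)

lemma V_nonzero: "V \<noteq> 0"
  using V_unit zero_left[OF V_in] by auto

lemma change_V: "w \<in> W \<Longrightarrow> change t V w = (1 - t) * b V w"
  unfolding change_def using V_unit by (simp add: algebra_simps)

lemma orthogonal_positive: "u \<in> W \<Longrightarrow> u \<noteq> 0 \<Longrightarrow> b V u = 0 \<Longrightarrow> b u u > 0"
  using timelike_complement_positive[OF signature V_in] V_unit by auto

text \<open>The orthogonal projection to the complement of \<open>V\<close> subtracts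
  \<open>b V u / b V V\<close> times \<open>V\<close>; since \<open>b V V = - 1\<close>, this
  becomes the plus sign.\<close>

lemma change_1_projection:
  assumes u: "u \<in> W"
  shows "change 1 u u = b (u + b V u *\<^sub>R V) (u + b V u *\<^sub>R V)" "b V (u + b V u *\<^sub>R V) = 0"
proof -
  let ?c = "b V u"
  have cV: "?c *\<^sub>R V \<in> W" and w: "u + ?c *\<^sub>R V \<in> W"
    using u V_in subspace by (simp_all add: subspace_add subspace_scale)
  show *: "b V (u + ?c *\<^sub>R V) = 0"
    using u V_in cV V_unit by (simp add: add_right scale_right)
  have uV: "b u V = ?c" using sym u V_in by blast
  have "b (u + ?c *\<^sub>R V) (u + ?c *\<^sub>R V) = b u (u + ?c *\<^sub>R V) + ?c * b V (u + ?c *\<^sub>R V)"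
    using u V_in cV w by (simp only: add_left scale_left)
  also have "\<dots> = b u u + ?c * b u V"
    unfolding * using u V_in cV by (simp add: add_right scale_right)
  finally show "change 1 u u = b (u + ?c *\<^sub>R V) (u + ?c *\<^sub>R V)"
    unfolding change_def uV by simp
qed

text \<open>Positivity of \<open>b\<close> on the complement of \<open>V\<close> passes to
  \<open>change 1\<close> through the projection, whose kernel is the line through
  \<open>V\<close>.\<close>

lemma change_1_nonneg:
  assumes u: "u \<in> W"
  shows "change 1 u u \<ge> 0" "change 1 u u = 0 \<longleftrightarrow> u \<in> span {V}"
proof -
  let ?w = "u + b V u *\<^sub>R V"
  have w: "?w \<in> W" using u V_in subspace by (simp add: subspace_add subspace_scale)
  have pos: "?w \<noteq> 0 \<Longrightarrow> change 1 u u > 0"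
    using orthogonal_positive[OF w] change_1_projection[OF u] by simp
  have zero: "?w = 0 \<Longrightarrow> change 1 u u = 0"
    using change_1_projection[OF u] zero_left[OF subspace_0[OF subspace]] by simp
  show "change 1 u u \<ge> 0" using pos zero by (cases "?w = 0") auto
  show "change 1 u u = 0 \<longleftrightarrow> u \<in> span {V}"
  proof
    assume "change 1 u u = 0"
    then have "u = (- b V u) *\<^sub>R V" using pos by (auto simp: add_eq_0_iff2)
    then show "u \<in> span {V}" by (metis span_base span_scale singletonI)
  next
    assume "u \<in> span {V}"
    then obtain k where "u = k *\<^sub>R V" by (auto simp: span_singleton)
    then have "?w = 0" using V_in V_unit by (simp add: scale_right)
    then show "change 1 u u = 0" by (rule zero)
  qed
qed

text \<open>A radical vector \<open>u\<close> satisfies in particular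
  \<open>change 1 u u = 0\<close>, so the null vectors already bound the radical; conversely the
  factor \<open>1 - t\<close> of \<open>change_V\<close> vanishes.\<close>

lemma radical_change_1: "radical_on W (change 1) = span {V}"
proof
  show "radical_on W (change 1) \<subseteq> span {V}"
    unfolding radical_on_def using change_1_nonneg(2) by auto
  show "span {V} \<subseteq> radical_on W (change 1)"
  proof
    fix u assume "u \<in> span {V}"
    then obtain k where k: "u = k *\<^sub>R V" by (auto simp: span_singleton)
    interpret c: bilinear_subspace W "change 1"
      using subspace bilinear_change by unfold_locales
    show "u \<in> radical_on W (change 1)"
      unfolding radical_on_def k using V_in subspace
      by (auto simp: c.scale_left change_V subspace_scale)
  qed
qed

lemma degenerate_change_iff: "degenerate_on W (change t) \<longleftrightarrow> t = 1"
proof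
  assume "degenerate_on W (change t)"
  then obtain w where w: "w \<in> W" "w \<noteq> 0" "\<forall>u\<in>W. change t w u = 0"
    unfolding degenerate_on_def radical_on_def by auto
  show "t = 1"
  proof (rule ccontr)
    assume t: "t \<noteq> 1"
    have "change t V w = change t w V" using bilinear_change w(1) V_in
      unfolding symmetric_bilinear_on_def by blast
    \<comment> \<open>For \<open>t \<noteq> 1\<close>, pairing with \<open>V\<close> forces a
      radical vector \<open>w\<close> to be orthogonal to \<open>V\<close>. There the added term
      vanishes and \<open>b\<close> is positive, which leaves no nonzero \<open>w\<close>.\<close>
    then have "b V w = 0" using w V_in t by (simp add: change_V)
    moreover have "change t w w = 0" using w by blast
    ultimately have "b w w = 0" by (simp add: change_def)
    then show False using orthogonal_positive[OF w(1,2)] \<open>b V w = 0\<close> by simp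
  qed
next
  assume "t = 1"
  then show "degenerate_on W (change t)"
    unfolding degenerate_on_def using radical_change_1 V_nonzero span_base by blast
qed

text \<open>The radical is a line, so it is either contained in \<open>K\<close> or meets it only in
  0; in the second case every nonzero vector of \<open>K\<close> avoids the null vectors of
  \<open>change 1\<close>.\<close>

lemma positive_definite_of_transverse_radical:
  assumes K: "subspace K" "K \<subseteq> W" and rad: "\<not> radical_on W (change 1) \<subseteq> K"
  shows "positive_definite_on K (change 1)"
  unfolding positive_definite_on_def
proof (intro ballI impI)
  fix u assume u: "u \<in> K" "u \<noteq> 0"
  have V: "V \<notin> K" using rad span_minimal[of "{V}" K] K(1) unfolding radical_change_1 by blast
  have "u \<notin> span {V}"
  proof
    assume "u \<in> span {V}"
    then obtain k where k: "u = k *\<^sub>R V" by (auto simp: span_singleton)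
    then have "k \<noteq> 0" using u by auto
    then have "V = (1 / k) *\<^sub>R u" using k by simp
    then show False using V u K(1) subspace_scale by metis
  qed
  then show "change 1 u u > 0" using change_1_nonneg[of u] u K(2) by (metis subsetD less_le)
qed

lemma dim_eq: "dim W = l + 1"
proof -
  obtain E where E: "finite E" "independent E" "span E = W"
    "card {x\<in>E. b x x = 0} = 0" "card {x\<in>E. b x x < 0} = 1" "card {x\<in>E. b x x > 0} = l"
    using signature unfolding has_signature_def by blast
  let ?N = "{x\<in>E. b x x < 0}" and ?P = "{x\<in>E. b x x > 0}"
  have "{x\<in>E. b x x = 0} = {}" using E(1,4) by simp
  then have "E = ?N \<union> ?P" by (auto simp: set_eq_iff)
  moreover have "card (?N \<union> ?P) = card ?N + card ?P"
    using E(1) by (intro card_Un_disjoint) auto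
  ultimately have "card E = l + 1" using E(5,6) by simp
  then show ?thesis using E dim_span_eq_card_independent by metis
qed

text \<open>The type \<open>'v\<close> need not be finite-dimensional, so finiteness of independent
  sets in \<open>W\<close> has to come from the orthogonal basis behind the signature.\<close>

lemma finite_span: obtains S where "finite S" "span S = W"
  using signature unfolding has_signature_def by blast

text \<open>In the application \<open>\<phi>\<close> is the differential of \<open>f\<close>. Its
  kernel \<open>K\<close> splits orthogonally into the line through \<open>V\<close> and the part
  \<open>P\<close> of \<open>K\<close> orthogonal to \<open>V\<close>: an orthogonal basis of
  \<open>P\<close> supplies the plus signs, \<open>V\<close> the zero. The vector \<open>z\<close>
  is the one direction missing from \<open>K\<close> and makes the dimension count possible.\<close>

lemma hyperplane_through_radical:
  assumes add: "\<And>u v. u \<in> W \<Longrightarrow> v \<in> W \<Longrightarrow> \<phi> (u + v) = \<phi> u + \<phi> v"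
    and scale: "\<And>r u. u \<in> W \<Longrightarrow> \<phi> (r *\<^sub>R u) = r * \<phi> u"
    and z: "z \<in> W" "\<phi> z \<noteq> (0::real)" and V: "\<phi> V = 0" and K: "K = {u \<in> W. \<phi> u = 0}"
  shows "has_signature K (change 1) 1 0 (l - 1)" "degenerate_on K (change 1)"
    "positive_semidefinite_on K (change 1)"
proof -
  have phi_0: "\<phi> 0 = 0" using scale[of V 0] V_in by simp
  have sK: "subspace K" unfolding K
    using add scale phi_0 subspace by (auto simp: subspace_def)
  have VK: "V \<in> K" unfolding K using V V_in by simp
  have KW: "K \<subseteq> W" unfolding K by blast
  show "positive_semidefinite_on K (change 1)"
    unfolding positive_semidefinite_on_def using change_1_nonneg(1) KW by blast
  have V_rad: "change 1 V u = 0" if "u \<in> W" for u using change_V that by simp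
  show "degenerate_on K (change 1)"
    unfolding degenerate_on_def radical_on_def using VK V_nonzero V_rad KW
    by (intro bexI[of _ V]) auto
  define P where "P = {u \<in> K. b V u = 0}"
  have sP: "subspace P" unfolding P_def
    using sK KW V_in by (auto simp: subspace_def add_right scale_right zero_right subset_eq)
  have PW: "P \<subseteq> W" unfolding P_def using KW by blast
  interpret P: bilinear_subspace P b
    using sP bilinear PW unfolding symmetric_bilinear_on_def
    by unfold_locales (auto simp: symmetric_bilinear_on_def subset_eq)
  have pdP: "positive_definite_on P b"
    unfolding positive_definite_on_def using orthogonal_positive PW by (auto simp: P_def)
  obtain S where S: "finite S" "span S = W" by (rule finite_span)
  \<comment> \<open>A basis of \<open>P\<close> is finite because it lies in the span of the finite
    set \<open>S\<close>; Gram-Schmidt then makes it orthogonal.\<close>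
  obtain B where B: "B \<subseteq> P" "independent B" "P \<subseteq> span B" by (rule maximal_independent_subset)
  have "B \<subseteq> span S" using B(1) PW S(2) by simp
  from independent_span_bound[OF S(1) B(2) this] have "finite B" by (rule conjunct1)
  from P.orthogonal_basis_of_span[OF this B(1) pdP]
  obtain E where E: "finite E" "E \<subseteq> P" "independent E" "span E = span B"
    "\<forall>x\<in>E. \<forall>y\<in>E. x \<noteq> y \<longrightarrow> b x y = 0"
    by (elim exE conjE) (rule that)
  have spE: "span E = P" using E(4) span_subspace[OF B(1,3) sP] by simp
  have VP: "V \<notin> span E" unfolding spE P_def using V_unit by simp
  have iVE: "independent (insert V E)" using VP E(3) by (rule independent_insertI)
  have spVE: "span (insert V E) = K"
  proof
    show "span (insert V E) \<subseteq> K" using E(2) VK sK by (intro span_minimal) (auto simp: P_def)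
    show "K \<subseteq> span (insert V E)"
    proof
      fix u assume u: "u \<in> K"
      have "b V (u + b V u *\<^sub>R V) = 0" using change_1_projection(2) u KW by blast
      then have "u - (- b V u) *\<^sub>R V \<in> span E"
        unfolding spE P_def using u VK sK by (simp add: subspace_add subspace_scale)
      then show "u \<in> span (insert V E)" unfolding span_breakdown_eq by blast
    qed
  qed
  have zK: "z \<notin> span (insert V E)" unfolding spVE K using z by simp
  have "span (insert z (insert V E)) = W"
  proof
    show "span (insert z (insert V E)) \<subseteq> W"
      using z V_in E(2) PW subspace by (intro span_minimal) auto
    show "W \<subseteq> span (insert z (insert V E))"
    proof
      fix u assume u: "u \<in> W"
      \<comment> \<open>The coefficient is chosen to cancel \<open>\<phi> u\<close>, which moves
        \<open>u\<close> along \<open>z\<close> into \<open>K\<close>.\<close>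
      let ?w = "u + (- \<phi> u / \<phi> z) *\<^sub>R z"
      have cz: "(- \<phi> u / \<phi> z) *\<^sub>R z \<in> W" using z(1) subspace subspace_scale by blast
      have "\<phi> ?w = 0" using add[OF u cz] scale[OF z(1)] z(2) by (simp del: scaleR_minus_left)
      moreover have "?w \<in> W" using u cz subspace subspace_add by blast
      ultimately have "?w \<in> K" unfolding K by blast
      then have "u - (\<phi> u / \<phi> z) *\<^sub>R z \<in> span (insert V E)" unfolding spVE by simp
      then show "u \<in> span (insert z (insert V E))"
        using span_breakdown_eq[of u z "insert V E"] by blast
    qed
  qed
  moreover have "independent (insert z (insert V E))" using zK iVE by (rule independent_insertI)
  \<comment> \<open>\<open>z\<close> and \<open>V\<close> account for two of the
    \<open>l + 1\<close> basis vectors of \<open>W\<close>, which leaves \<open>l - 1\<close> for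
    \<open>E\<close>.\<close>
  ultimately have "card (insert z (insert V E)) = l + 1"
    using dim_eq dim_span_eq_card_independent by metis
  moreover have "z \<notin> insert V E" "V \<notin> E" using zK VP span_base by blast+
  ultimately have cE: "card E = l - 1" using E(1) by simp
  have posE: "change 1 x x > 0" if "x \<in> E" for x
  proof -
    have "x \<noteq> 0" using that E(3) dependent_zero by metis
    moreover have "x \<in> P" using that E(2) by blast
    ultimately show ?thesis using pdP unfolding positive_definite_on_def by (simp add: change_def P_def)
  qed
  have VV: "change 1 V V = 0" using V_rad V_in by blast
  have "{x \<in> insert V E. change 1 x x = 0} = {V}" "{x \<in> insert V E. change 1 x x < 0} = {}"
    "{x \<in> insert V E. change 1 x x > 0} = E"
    using posE VV \<open>V \<notin> E\<close> by (auto dest: less_asym) (metis less_irrefl)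
  moreover have "\<forall>x\<in>insert V E. \<forall>y\<in>insert V E. x \<noteq> y \<longrightarrow> change 1 x y = 0"
  proof (intro ballI impI)
    fix x y assume xy: "x \<in> insert V E" "y \<in> insert V E" "x \<noteq> y"
    have EW: "E \<subseteq> W" using E(2) PW by blast
    have *: "change 1 x y = change 1 y x" using bilinear_change xy EW V_in
      unfolding symmetric_bilinear_on_def by blast
    show "change 1 x y = 0"
    proof (cases "x = V \<or> y = V")
      case True
      then show ?thesis using * V_rad xy EW V_in by (metis insert_iff subsetD)
    next
      case False
      then show ?thesis using xy E(2,5) by (auto simp: change_def P_def subset_eq)
    qed
  qed
  ultimately show "has_signature K (change 1) 1 0 (l - 1)"
    unfolding has_signature_def using E(1) iVE spVE cE
    by (intro exI[of _ "insert V E"]) simp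
qed

end


section \<open>Calculus of smooth maps on open sets\<close>

lemma Ck_on_subset: "Ck_on k S f \<Longrightarrow> T \<subseteq> S \<Longrightarrow> Ck_on k T f"
  by (induction k arbitrary: f) (auto intro: continuous_on_subset)

lemma Ck_on_SucD: "Ck_on (Suc k) S f \<Longrightarrow> Ck_on k S f"
proof (induction k arbitrary: f)
  case 0
  then show ?case
    by (auto intro!: continuous_at_imp_continuous_on differentiable_imp_continuous_within)
next
  case (Suc k)
  note * = Suc.prems[unfolded Ck_on.simps(2)[of "Suc k"]]
  show ?case unfolding Ck_on.simps(2)[of k] using * Suc.IH by blast
qed

text \<open>Openness of \<open>S\<close> makes equality on \<open>S\<close> an equality near each of
  its points, so it passes to the derivatives.\<close>

lemma Ck_on_cong:
  assumes "open S" "\<And>x. x \<in> S \<Longrightarrow> f x = g x" "Ck_on k S f"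
  shows "Ck_on k S g"
  using assms(2,3)
proof (induction k arbitrary: f g)
  case 0
  then show ?case using continuous_on_cong[of S S f g] by auto
next
  case (Suc k)
  have diff: "f differentiable at x" if "x \<in> S" for x using Suc.prems that by simp
  have "g differentiable at x" if "x \<in> S" for x
    using diff[OF that] has_derivative_transform_within_open[OF _ assms(1) that, of f _ UNIV g] Suc.prems(1)
    unfolding differentiable_def by blast
  moreover have "frechet_derivative f (at x) v = frechet_derivative g (at x) v" if "x \<in> S" for x v
    using frechet_derivative_transform_within_open[OF diff[OF that] assms(1) that Suc.prems(1)] by simp
  then have "Ck_on k S (\<lambda>x. frechet_derivative g (at x) v)" for v
    using Suc.IH[of "\<lambda>x. frechet_derivative f (at x) v" "\<lambda>x. frechet_derivative g (at x) v"]
      Suc.prems(2) by simp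
  ultimately show ?case by simp
qed

text \<open>Differentiability at a point sees only a neighbourhood. This matters because a chart
  around an image point and a smooth representative of the line element are available only
  locally.\<close>

lemma Ck_on_local:
  assumes "\<And>x. x \<in> S \<Longrightarrow> \<exists>N. open N \<and> x \<in> N \<and> Ck_on k N f"
  shows "Ck_on k S f"
  using assms
proof (induction k arbitrary: f)
  case 0
  have "isCont f x" if x: "x \<in> S" for x
  proof -
    obtain N where "open N" "x \<in> N" "continuous_on N f" using 0[OF x] by auto
    then show ?thesis by (simp add: continuous_on_eq_continuous_at)
  qed
  then show ?case by (auto intro: continuous_at_imp_continuous_on)
next
  case (Suc k)
  have "f differentiable at x" if "x \<in> S" for x using Suc.prems[OF that] by auto
  moreover have "Ck_on k S (\<lambda>x. frechet_derivative f (at x) v)" for v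
  proof (rule Suc.IH)
    fix x assume "x \<in> S"
    from Suc.prems[OF this] obtain N where "open N" "x \<in> N" "Ck_on (Suc k) N f" by blast
    then show "\<exists>N. open N \<and> x \<in> N \<and> Ck_on k N (\<lambda>x. frechet_derivative f (at x) v)" by auto
  qed
  ultimately show ?case by simp
qed

lemma Ck_on_const: "Ck_on k S (\<lambda>x. c)"
  by (induction k arbitrary: c) simp_all

text \<open>Lets a closure rule be proved from an explicit formula for the derivative, in place of
  the chosen \<open>frechet_derivative\<close>.\<close>

lemma Ck_on_SucI:
  assumes S: "open S" and der: "\<And>x. x \<in> S \<Longrightarrow> (f has_derivative f' x) (at x)"
    and Ck: "\<And>v. Ck_on k S (\<lambda>x. f' x v)"
  shows "Ck_on (Suc k) S f"
proof -
  have eq: "f' x v = frechet_derivative f (at x) v" if "x \<in> S" for x v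
    using frechet_derivative_at[OF der[OF that]] by simp
  have "Ck_on k S (\<lambda>x. frechet_derivative f (at x) v)" for v
    by (rule Ck_on_cong[OF S eq Ck])
  then show ?thesis using der by (auto simp: differentiable_def)
qed

lemma Ck_on_Suc_has_derivative:
  "Ck_on (Suc k) S f \<Longrightarrow> x \<in> S \<Longrightarrow> (f has_derivative frechet_derivative f (at x)) (at x)"
  by (simp add: frechet_derivative_works[symmetric])

lemma Ck_on_bounded_linear:
  assumes "open S" "bounded_linear L" "Ck_on k S f"
  shows "Ck_on k S (\<lambda>x. L (f x))"
  using assms(3)
proof (induction k arbitrary: f)
  case 0
  then show ?case using bounded_linear.continuous_on[OF assms(2)] by simp
next
  case (Suc k)
  show ?case
    using Suc.prems Suc.IH
    by (intro Ck_on_SucI[OF assms(1) bounded_linear.has_derivative[OF assms(2)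
          Ck_on_Suc_has_derivative[OF Suc.prems]]]) auto
qed

lemma Ck_on_add:
  assumes "open S" "Ck_on k S f" "Ck_on k S g"
  shows "Ck_on k S (\<lambda>x. f x + g x)"
  using assms(2,3)
proof (induction k arbitrary: f g)
  case 0
  then show ?case by (simp add: continuous_on_add)
next
  case (Suc k)
  show ?case
    using Suc.prems Suc.IH
    by (intro Ck_on_SucI[OF assms(1) has_derivative_add[OF Ck_on_Suc_has_derivative[OF Suc.prems(1)]
        Ck_on_Suc_has_derivative[OF Suc.prems(2)]]]) auto
qed

lemma Ck_on_sum:
  assumes "open S" "finite I" "\<And>i. i \<in> I \<Longrightarrow> Ck_on k S (f i)"
  shows "Ck_on k S (\<lambda>x. \<Sum>i\<in>I. f i x)"
  using assms(2,3)
  by (induction I rule: finite_induct) (auto intro: Ck_on_const Ck_on_add[OF assms(1)])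

text \<open>The product rule leaves \<open>r\<close> and \<open>f\<close> themselves next to
  derivatives, so the induction needs them at the lower order as well, through
  \<open>Ck_on_SucD\<close>.\<close>

lemma Ck_on_scaleR:
  fixes r :: "'a::real_normed_vector \<Rightarrow> real"
  assumes "open S" "Ck_on k S r" "Ck_on k S f"
  shows "Ck_on k S (\<lambda>x. r x *\<^sub>R f x)"
  using assms(2,3)
proof (induction k arbitrary: r f)
  case 0
  then show ?case by (simp add: continuous_on_scaleR)
next
  case (Suc k)
  show ?case
    using Suc.prems Suc.IH Ck_on_SucD[OF Suc.prems(1)] Ck_on_SucD[OF Suc.prems(2)]
    by (intro Ck_on_SucI[OF assms(1) has_derivative_scaleR[OF Ck_on_Suc_has_derivative[OF Suc.prems(1)]
        Ck_on_Suc_has_derivative[OF Suc.prems(2)]]] Ck_on_add[OF assms(1)]) auto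
qed

text \<open>In the chain rule both the linear map and its argument vary with the point. Expanding
  the argument in the finite basis turns the derivative into a sum of scalar components times
  \<open>?f' (F x) i\<close>; these are again compositions with \<open>F\<close>, so the induction
  is over all \<open>f\<close>.\<close>

lemma Ck_on_compose:
  fixes F :: "'a::real_normed_vector \<Rightarrow> 'b::euclidean_space" and f :: "'b \<Rightarrow> 'c::real_normed_vector"
  assumes "open S" "F ` S \<subseteq> T" "Ck_on k S F" "Ck_on k T f"
  shows "Ck_on k S (\<lambda>x. f (F x))"
  using assms(3,4)
proof (induction k arbitrary: f)
  case 0
  then show ?case using continuous_on_compose2[of T f S F] assms(2) by simp
next
  case (Suc k)
  let ?f' = "\<lambda>y. frechet_derivative f (at y)" and ?F' = "\<lambda>x. frechet_derivative F (at x)"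
  have IH: "Ck_on k S (\<lambda>x. ?f' (F x) i)" for i
    using Suc.IH[of "\<lambda>y. ?f' y i"] Suc.prems Ck_on_SucD by auto
  show ?case
  proof (rule Ck_on_SucI[OF assms(1)])
    fix x assume x: "x \<in> S"
    have f: "(f has_derivative ?f' (F x)) (at (F x))"
      using Ck_on_Suc_has_derivative[OF Suc.prems(2)] x assms(2) by blast
    have lin: "linear (?f' (F x))" using f has_derivative_linear by blast
    have "((\<lambda>x. f (F x)) has_derivative (\<lambda>v. ?f' (F x) (?F' x v))) (at x)"
      using diff_chain_at[OF Ck_on_Suc_has_derivative[OF Suc.prems(1) x] f] by (simp add: o_def)
    moreover have "?f' (F x) w = (\<Sum>i\<in>Basis. (w \<bullet> i) *\<^sub>R ?f' (F x) i)" for w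
      using linear_sum[OF lin, of "\<lambda>i. (w \<bullet> i) *\<^sub>R i" Basis] linear_cmul[OF lin]
      by (simp add: euclidean_representation)
    then have "(\<lambda>v. ?f' (F x) (?F' x v)) = (\<lambda>v. \<Sum>i\<in>Basis. (?F' x v \<bullet> i) *\<^sub>R ?f' (F x) i)"
      by (rule ext)
    ultimately show "((\<lambda>x. f (F x)) has_derivative
        (\<lambda>v. \<Sum>i\<in>Basis. (?F' x v \<bullet> i) *\<^sub>R ?f' (F x) i)) (at x)" by simp
  next
    fix v
    have "Ck_on k S (\<lambda>x. ?F' x v \<bullet> i)" for i
      using Suc.prems(1) by (intro Ck_on_bounded_linear[OF assms(1) bounded_linear_inner_left]) simp
    then show "Ck_on k S (\<lambda>x. \<Sum>i\<in>Basis. (?F' x v \<bullet> i) *\<^sub>R ?f' (F x) i)"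
      by (intro Ck_on_sum[OF assms(1)] Ck_on_scaleR[OF assms(1)] IH finite_Basis)
  qed
qed

section \<open>Closure rules at all orders\<close>

lemma smooth_on_subset: "smooth_on S f \<Longrightarrow> T \<subseteq> S \<Longrightarrow> smooth_on T f"
  unfolding smooth_on_def using Ck_on_subset by blast

lemma smooth_on_cong:
  "open S \<Longrightarrow> (\<And>x. x \<in> S \<Longrightarrow> f x = g x) \<Longrightarrow> smooth_on S f \<Longrightarrow> smooth_on S g"
  unfolding smooth_on_def using Ck_on_cong by blast

lemma smooth_on_local:
  "(\<And>x. x \<in> S \<Longrightarrow> \<exists>N. open N \<and> x \<in> N \<and> smooth_on N f) \<Longrightarrow> smooth_on S f"
  unfolding smooth_on_def by (intro allI Ck_on_local) blast

lemma smooth_on_differentiable: "smooth_on S f \<Longrightarrow> x \<in> S \<Longrightarrow> f differentiable at x"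
  unfolding smooth_on_def using Ck_on.simps(2)[of 0 S f] by blast

lemma smooth_on_frechet_derivative:
  "smooth_on S f \<Longrightarrow> smooth_on S (\<lambda>x. frechet_derivative f (at x) v)"
  unfolding smooth_on_def using Ck_on.simps(2) by blast

lemma smooth_on_const: "smooth_on S (\<lambda>x. c)"
  unfolding smooth_on_def using Ck_on_const by blast

lemma smooth_on_ident: "open S \<Longrightarrow> smooth_on S (\<lambda>x. x)"
  unfolding smooth_on_def
proof
  fix k assume "open S"
  then show "Ck_on k S (\<lambda>x. x)"
    by (cases k) (auto intro: Ck_on_SucI has_derivative_ident Ck_on_const)
qed

lemma smooth_on_inner: "open S \<Longrightarrow> smooth_on S f \<Longrightarrow> smooth_on S (\<lambda>x. f x \<bullet> i)"
  unfolding smooth_on_def using Ck_on_bounded_linear[OF _ bounded_linear_inner_left, of S _ f i] by simp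

lemma smooth_on_add: "open S \<Longrightarrow> smooth_on S f \<Longrightarrow> smooth_on S g \<Longrightarrow> smooth_on S (\<lambda>x. f x + g x)"
  unfolding smooth_on_def using Ck_on_add[of S _ f g] by simp

lemma smooth_on_sum:
  "open S \<Longrightarrow> finite I \<Longrightarrow> (\<And>i. i \<in> I \<Longrightarrow> smooth_on S (f i)) \<Longrightarrow> smooth_on S (\<lambda>x. \<Sum>i\<in>I. f i x)"
  unfolding smooth_on_def using Ck_on_sum[of S I _ f] by simp

lemma smooth_on_mult:
  fixes r s :: "'a::real_normed_vector \<Rightarrow> real"
  shows "open S \<Longrightarrow> smooth_on S r \<Longrightarrow> smooth_on S s \<Longrightarrow> smooth_on S (\<lambda>x. r x * s x)"
  unfolding smooth_on_def using Ck_on_scaleR[of S _ r s] by simp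

lemma smooth_on_compose:
  fixes F :: "'a::real_normed_vector \<Rightarrow> 'b::euclidean_space" and f :: "'b \<Rightarrow> 'c::real_normed_vector"
  shows "open S \<Longrightarrow> F ` S \<subseteq> T \<Longrightarrow> smooth_on S F \<Longrightarrow> smooth_on T f \<Longrightarrow> smooth_on S (\<lambda>x. f (F x))"
  unfolding smooth_on_def using Ck_on_compose[of S F T _ f] by simp


section \<open>Charts and tangent spaces\<close>

lemma chart_inv_chart:
  assumes "is_chart X c" "p \<in> fst c" shows "chart_inv c (snd c p) = p"
proof -
  have "inj_on (snd c) (topspace (subtopology X (fst c)))"
    using assms(1) homeomorphic_imp_injective_map unfolding is_chart_def by blast
  moreover have "topspace (subtopology X (fst c)) = fst c"
    using assms(1) openin_subset unfolding is_chart_def by fastforce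
  ultimately show ?thesis using assms(2) by (simp add: chart_inv_def)
qed

lemma open_chart_image:
  assumes c: "is_chart X c" and P: "openin X P" shows "open (snd c ` (fst c \<inter> P))"
proof -
  have "open_map (subtopology X (fst c)) (top_of_set (snd c ` fst c)) (snd c)"
    using c homeomorphic_imp_open_map unfolding is_chart_def by blast
  moreover have "openin (subtopology X (fst c)) (fst c \<inter> P)"
    using P by (metis inf_commute openin_subtopology_Int)
  ultimately have "openin (top_of_set (snd c ` fst c)) (snd c ` (fst c \<inter> P))"
    unfolding open_map_def by blast
  then show ?thesis using c openin_open_trans unfolding is_chart_def by blast
qed

lemma chart_image_elim:
  assumes "is_chart X c" "x \<in> snd c ` (fst c \<inter> P)"
  shows "chart_inv c x \<in> fst c" "chart_inv c x \<in> P" "snd c (chart_inv c x) = x"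
  using assms chart_inv_chart[OF assms(1)] by auto

text \<open>\<open>F = id\<close> gives the change of charts.\<close>

lemma derivative_through_chart:
  fixes G :: "'n \<Rightarrow> 'k::real_normed_vector"
  assumes b: "is_chart Y b" "p \<in> fst b" and d: "is_chart X d"
    and P: "openin Y P" "p \<in> P" "F ` P \<subseteq> fst d"
    and F: "(snd d \<circ> F \<circ> chart_inv b) differentiable at (snd b p)"
    and G: "(G \<circ> chart_inv d) differentiable at (snd d (F p))"
  shows "(G \<circ> F \<circ> chart_inv b) differentiable at (snd b p)"
    "frechet_derivative (G \<circ> F \<circ> chart_inv b) (at (snd b p)) w =
      frechet_derivative (G \<circ> chart_inv d) (at (snd d (F p)))
        (frechet_derivative (snd d \<circ> F \<circ> chart_inv b) (at (snd b p)) w)"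
proof -
  let ?N = "snd b ` (fst b \<inter> P)" and ?D = "snd d \<circ> F \<circ> chart_inv b"
  \<comment> \<open>This composite is known to agree with
    \<open>G \<circ> F \<circ> chart_inv b\<close> only where \<open>F\<close> lands in the domain
    of \<open>d\<close>, hence the passage to the open set \<open>?N\<close> around the
    point.\<close>
  let ?C = "(G \<circ> chart_inv d) \<circ> ?D"
  have N: "open ?N" "snd b p \<in> ?N" using open_chart_image[OF b(1) P(1)] b P by auto
  have eq: "?C x = (G \<circ> F \<circ> chart_inv b) x" if "x \<in> ?N" for x
  proof -
    have "F (chart_inv b x) \<in> fst d" using chart_image_elim(2)[OF b(1) that] P(3) by blast
    then show ?thesis using chart_inv_chart[OF d] by simp
  qed
  have pt: "?D (snd b p) = snd d (F p)" using chart_inv_chart[OF b] by simp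
  have diff: "?C differentiable at (snd b p)" using F G pt by (intro differentiable_chain_at) simp_all
  then have "(?C has_derivative frechet_derivative ?C (at (snd b p))) (at (snd b p))"
    using frechet_derivative_works by blast
  then have "((G \<circ> F \<circ> chart_inv b) has_derivative frechet_derivative ?C (at (snd b p))) (at (snd b p))"
    by (rule has_derivative_transform_within_open[OF _ N eq])
  then show "(G \<circ> F \<circ> chart_inv b) differentiable at (snd b p)"
    by (rule Derivative.differentiableI)
  have "frechet_derivative (G \<circ> F \<circ> chart_inv b) (at (snd b p)) = frechet_derivative ?C (at (snd b p))"
    by (rule frechet_derivative_transform_within_open[OF diff N eq, symmetric])
  also have "\<dots> = frechet_derivative (G \<circ> chart_inv d) (at (snd d (F p))) \<circ>
      frechet_derivative ?D (at (snd b p))"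
    using frechet_derivative_compose[of ?D "snd b p" "G \<circ> chart_inv d"] F G unfolding pt by simp
  finally show "frechet_derivative (G \<circ> F \<circ> chart_inv b) (at (snd b p)) w =
      frechet_derivative (G \<circ> chart_inv d) (at (snd d (F p)))
        (frechet_derivative ?D (at (snd b p)) w)" by simp
qed

locale atlas =
  fixes X :: "'m topology" and A :: "('m, 'e::euclidean_space) chart set"
  assumes manifold: "smooth_manifold X A"
begin

lemma chart: "c \<in> A \<Longrightarrow> is_chart X c"
  using manifold unfolding smooth_manifold_def by blast

lemma charts_atD: "c \<in> charts_at A p \<Longrightarrow> c \<in> A" "c \<in> charts_at A p \<Longrightarrow> p \<in> fst c"
    "c \<in> charts_at A p \<Longrightarrow> is_chart X c"
  unfolding charts_at_def using chart by auto

lemma chart_domain_open: "c \<in> A \<Longrightarrow> openin X (fst c)"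
  using chart unfolding is_chart_def by blast

lemma charts_at_nonempty: assumes "p \<in> topspace X" obtains c where "c \<in> charts_at A p"
  using assms manifold unfolding smooth_manifold_def charts_at_def by blast

lemma some_chart: "p \<in> topspace X \<Longrightarrow> (SOME c. c \<in> charts_at A p) \<in> charts_at A p"
  using charts_at_nonempty someI_ex by metis

lemma open_chart_image': "c \<in> A \<Longrightarrow> open (snd c ` fst c)"
  using chart unfolding is_chart_def by blast

lemma transition_differentiable:
  assumes "c \<in> charts_at A p" "d \<in> charts_at A p"
  shows "(snd d \<circ> chart_inv c) differentiable at (snd c p)"
proof (rule smooth_on_differentiable)
  show "smooth_on (snd c ` (fst c \<inter> fst d)) (snd d \<circ> chart_inv c)"
    using manifold assms unfolding smooth_manifold_def charts_at_def by blast
  show "snd c p \<in> snd c ` (fst c \<inter> fst d)" using assms charts_atD(2) by blast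
qed

lemma change_chart:
  assumes c: "c \<in> charts_at A p" and d: "d \<in> charts_at A p"
    and G: "(G \<circ> chart_inv d) differentiable at (snd d p)"
  shows "frechet_derivative (G \<circ> chart_inv c) (at (snd c p)) w =
    frechet_derivative (G \<circ> chart_inv d) (at (snd d p))
      (frechet_derivative (snd d \<circ> chart_inv c) (at (snd c p)) w)"
  using derivative_through_chart(2)[of X c p X d "fst d" id G w] charts_atD[OF c] charts_atD[OF d]
    chart_domain_open transition_differentiable[OF c d] G by simp

text \<open>The coordinate change from a chart to itself is known to be the identity only on the
  chart image, which suffices since that image is open.\<close>

lemma coord_vector_self:
  assumes c: "c \<in> charts_at A p" shows "coord_vector A c p a c = a"
proof -
  have "frechet_derivative id (at (snd c p)) = frechet_derivative (snd c \<circ> chart_inv c) (at (snd c p))"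
    using open_chart_image'[OF charts_atD(1)[OF c]] charts_atD(2)[OF c] chart_inv_chart[OF charts_atD(3)[OF c]]
    by (intro frechet_derivative_transform_within_open[where X = "snd c ` fst c"])
      (auto simp: id_def)
  then have "frechet_derivative (snd c \<circ> chart_inv c) (at (snd c p)) = id" by simp
  then show ?thesis using c by (simp add: coord_vector_def)
qed

lemma coord_vector_in_tangent_space:
  assumes c: "c \<in> charts_at A p" shows "coord_vector A c p a \<in> tangent_space A p"
  unfolding tangent_space_def mem_Collect_eq
proof (intro conjI allI ballI impI)
  fix d e assume d: "d \<in> charts_at A p" and e: "e \<in> charts_at A p"
  show "coord_vector A c p a e =
      frechet_derivative (snd e \<circ> chart_inv d) (at (snd d p)) (coord_vector A c p a d)"
    using change_chart[OF c d transition_differentiable[OF d e]] d e by (simp add: coord_vector_def)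
qed (simp add: coord_vector_def)

lemma tangent_vector_eq_coord_vector:
  assumes "c \<in> charts_at A p" "v \<in> tangent_space A p"
  shows "v = coord_vector A c p (v c)"
proof
  fix d
  have "d \<in> charts_at A p \<Longrightarrow> v d = frechet_derivative (snd d \<circ> chart_inv c) (at (snd c p)) (v c)"
    and "d \<notin> charts_at A p \<Longrightarrow> v d = 0"
    using assms unfolding tangent_space_def by blast+
  then show "v d = coord_vector A c p (v c) d" by (simp add: coord_vector_def)
qed

lemma linear_coord_vector:
  assumes c: "c \<in> charts_at A p" shows "linear (coord_vector A c p)"
proof -
  have "linear (frechet_derivative (snd d \<circ> chart_inv c) (at (snd c p)))" if "d \<in> charts_at A p" for d
    using linear_frechet_derivative[OF transition_differentiable[OF c that]] .
  then show ?thesis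
    by (intro linearI) (auto simp: coord_vector_def fun_eq_iff scaleR_fun_def linear_add linear_cmul)
qed

lemma subspace_tangent_space:
  assumes "p \<in> topspace X" shows "subspace (tangent_space A p)"
proof -
  obtain c where c: "c \<in> charts_at A p" using charts_at_nonempty[OF assms] .
  have "tangent_space A p = range (coord_vector A c p)"
    using tangent_vector_eq_coord_vector[OF c] coord_vector_in_tangent_space[OF c] by blast
  then show ?thesis using linear_subspace_image[OF linear_coord_vector[OF c] subspace_UNIV] by simp
qed

lemma coord_vector_expand:
  assumes c: "c \<in> charts_at A p"
  shows "coord_vector A c p a = (\<Sum>i\<in>Basis. (a \<bullet> i) *\<^sub>R coord_vector A c p i)"
  using linear_sum[OF linear_coord_vector[OF c], of "\<lambda>i. (a \<bullet> i) *\<^sub>R i" Basis]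
    linear_cmul[OF linear_coord_vector[OF c]] by (simp add: euclidean_representation)

text \<open>Reduces a tensor on vectors with arbitrary components to its coefficients on fixed
  coordinate vectors, the functions whose smoothness is part of the definition.\<close>

lemma tensor_in_coordinates:
  assumes h: "symmetric_bilinear_on (tangent_space A p) h" and c: "c \<in> charts_at A p"
  shows "h (coord_vector A c p a) (coord_vector A c p b) =
    (\<Sum>i\<in>Basis. \<Sum>j\<in>Basis. (a \<bullet> i) * ((b \<bullet> j) * h (coord_vector A c p i) (coord_vector A c p j)))"
proof -
  have "p \<in> topspace X" using charts_atD[OF c] openin_subset[OF chart_domain_open] by blast
  then interpret bilinear_subspace "tangent_space A p" h
    using h subspace_tangent_space by unfold_locales
  let ?e = "coord_vector A c p"
  note e = coord_vector_in_tangent_space[OF c]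
  have "h (?e a) (?e b) = h (\<Sum>i\<in>Basis. (a \<bullet> i) *\<^sub>R ?e i) (?e b)"
    using coord_vector_expand[OF c, of a] by simp
  also have "\<dots> = (\<Sum>i\<in>Basis. (a \<bullet> i) * h (?e i) (?e b))"
    using e by (intro sum_scale_left) auto
  also have "\<dots> = (\<Sum>i\<in>Basis. (a \<bullet> i) * (\<Sum>j\<in>Basis. (b \<bullet> j) * h (?e i) (?e j)))"
  proof (intro sum.cong refl)
    fix i
    have "h (?e i) (?e b) = h (?e i) (\<Sum>j\<in>Basis. (b \<bullet> j) *\<^sub>R ?e j)"
      using coord_vector_expand[OF c, of b] by simp
    also have "\<dots> = (\<Sum>j\<in>Basis. (b \<bullet> j) * h (?e i) (?e j))"
      using e by (intro sum_scale_right) auto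
    finally show "(a \<bullet> i) * h (?e i) (?e b) = (a \<bullet> i) * (\<Sum>j\<in>Basis. (b \<bullet> j) * h (?e i) (?e j))" by simp
  qed
  finally show ?thesis by (simp add: sum_distrib_left)
qed

text \<open>The definition of a smooth tensor tests only constant components over the chart itself.
  Here the base point moves along \<open>F\<close> and the components vary, as happens for a
  pullback and for a field representing the line element.\<close>

lemma smooth_tensor_along:
  fixes F :: "'a::real_normed_vector \<Rightarrow> 'm"
  assumes h: "smooth_symmetric_tensor X A h" and c: "c \<in> A" and N: "open N"
    and F: "\<And>x. x \<in> N \<Longrightarrow> F x \<in> fst c" "smooth_on N (\<lambda>x. snd c (F x))"
    and ab: "smooth_on N a" "smooth_on N b"
  shows "smooth_on N (\<lambda>x. h (F x) (coord_vector A c (F x) (a x)) (coord_vector A c (F x) (b x)))"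
proof -
  let ?G = "\<lambda>i j y. h (chart_inv c y) (coord_vector A c (chart_inv c y) i) (coord_vector A c (chart_inv c y) j)"
  have inv: "chart_inv c (snd c (F x)) = F x" if "x \<in> N" for x
    using chart_inv_chart[OF chart[OF c] F(1)[OF that]] .
  have eq: "(\<Sum>i\<in>Basis. \<Sum>j\<in>Basis. (a x \<bullet> i) * ((b x \<bullet> j) * ?G i j (snd c (F x)))) =
      h (F x) (coord_vector A c (F x) (a x)) (coord_vector A c (F x) (b x))" if x: "x \<in> N" for x
  proof -
    have cF: "c \<in> charts_at A (F x)" using c F(1)[OF x] by (simp add: charts_at_def)
    have "F x \<in> topspace X" using F(1)[OF x] openin_subset[OF chart_domain_open[OF c]] by blast
    then have "symmetric_bilinear_on (tangent_space A (F x)) (h (F x))"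
      using h unfolding smooth_symmetric_tensor_def by blast
    from tensor_in_coordinates[OF this cF, of "a x" "b x", symmetric]
    show ?thesis unfolding inv[OF x] .
  qed
  have "smooth_on (snd c ` fst c) (?G i j)" for i j
    using h c unfolding smooth_symmetric_tensor_def by blast
  then have "smooth_on N (\<lambda>x. ?G i j (snd c (F x)))" for i j
    using F by (intro smooth_on_compose[OF N _ F(2), of "snd c ` fst c" "?G i j"]) auto
  then have "smooth_on N (\<lambda>x. \<Sum>i\<in>Basis. \<Sum>j\<in>Basis. (a x \<bullet> i) * ((b x \<bullet> j) * ?G i j (snd c (F x))))"
    by (intro smooth_on_sum[OF N] smooth_on_mult[OF N] smooth_on_inner[OF N] ab finite_Basis)
  then show ?thesis by (rule smooth_on_cong[OF N, rotated]) (rule eq)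
qed

lemma smooth_function_differentiable:
  assumes "smooth_function A f" "c \<in> charts_at A p"
  shows "(f \<circ> chart_inv c) differentiable at (snd c p)"
  using assms charts_atD[OF assms(2)] smooth_on_differentiable[of "snd c ` fst c" "f \<circ> chart_inv c"]
  unfolding smooth_function_def by blast

lemma diff_function_linear:
  assumes "smooth_function A f" "p \<in> topspace X"
  shows "diff_function A f p (u + v) = diff_function A f p u + diff_function A f p v"
    "diff_function A f p (r *\<^sub>R u) = r * diff_function A f p u"
  using linear_frechet_derivative[OF smooth_function_differentiable[OF assms(1) some_chart[OF assms(2)]]]
  by (simp_all add: diff_function_def Let_def scaleR_fun_def linear_add linear_cmul)

lemma subspace_ker_diff:
  assumes f: "smooth_function A f" and p: "p \<in> topspace X"
  shows "subspace (ker_diff A f p)"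
  using subspace_tangent_space[OF p] diff_function_linear[OF f p] diff_function_linear(2)[OF f p, of 0 0]
  unfolding ker_diff_def by (auto simp: subspace_def)

end

section \<open>Pullbacks\<close>

locale smooth_map_between = source: atlas Y B + target: atlas X A
  for Y :: "'m topology" and B :: "('m, 'h::euclidean_space) chart set"
    and X :: "'n topology" and A :: "('n, 'e::euclidean_space) chart set" +
  fixes F :: "'m \<Rightarrow> 'n"
  assumes smooth_F: "smooth_map Y B X A F"
begin

lemma F_in: "p \<in> topspace Y \<Longrightarrow> F p \<in> topspace X"
  using smooth_F continuous_map_image_subset_topspace unfolding smooth_map_def by blast

lemma openin_preimage_chart: "d \<in> A \<Longrightarrow> openin Y {y \<in> topspace Y. F y \<in> fst d}"
  using smooth_F target.chart_domain_open openin_continuous_map_preimage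
  unfolding smooth_map_def by blast

lemma smooth_in_charts:
  assumes "b \<in> B" "d \<in> A"
  shows "smooth_on (snd b ` (fst b \<inter> {y \<in> topspace Y. F y \<in> fst d})) (snd d \<circ> F \<circ> chart_inv b)"
proof -
  have "smooth_on (snd b ` (fst b \<inter> F -` fst d)) (snd d \<circ> F \<circ> chart_inv b)"
    using smooth_F assms unfolding smooth_map_def by metis
  then show ?thesis by (rule smooth_on_subset) blast
qed

context
  fixes p b d
  assumes p: "p \<in> topspace Y" and b: "b \<in> charts_at B p" and d: "d \<in> charts_at A (F p)"
begin

lemma differentiable_in_charts: "(snd d \<circ> F \<circ> chart_inv b) differentiable at (snd b p)"
  using smooth_on_differentiable[OF smooth_in_charts] source.charts_atD[OF b] target.charts_atD[OF d] p
  by blast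

lemma derivative_in_charts:
  assumes G: "(G \<circ> chart_inv d) differentiable at (snd d (F p))"
  shows "frechet_derivative (G \<circ> F \<circ> chart_inv b) (at (snd b p)) w =
      frechet_derivative (G \<circ> chart_inv d) (at (snd d (F p)))
        (frechet_derivative (snd d \<circ> F \<circ> chart_inv b) (at (snd b p)) w)"
  using p target.charts_atD[OF d] source.charts_atD[OF b]
  by (intro derivative_through_chart(2)[OF _ _ _ openin_preimage_chart[of d] _ _ differentiable_in_charts G]) auto

end

text \<open>Frees \<open>diff_map\<close> from the arbitrary chart in its definition: one chain rule
  changes the chart on the source, another splits off the chart \<open>d\<close> on the
  target.\<close>

lemma diff_map_eq_coord_vector:
  assumes p: "p \<in> topspace Y" and b: "b \<in> charts_at B p" and d: "d \<in> charts_at A (F p)"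
    and v: "v \<in> tangent_space B p"
  shows "diff_map B A F p v =
    coord_vector A d (F p) (frechet_derivative (snd d \<circ> F \<circ> chart_inv b) (at (snd b p)) (v b))"
proof -
  let ?c = "SOME c. c \<in> charts_at B p"
  have c: "?c \<in> charts_at B p" by (rule source.some_chart[OF p])
  have vc: "v ?c = frechet_derivative (snd ?c \<circ> chart_inv b) (at (snd b p)) (v b)"
    using v b c unfolding tangent_space_def by blast
  have "frechet_derivative (snd e \<circ> F \<circ> chart_inv ?c) (at (snd ?c p)) (v ?c) =
      frechet_derivative (snd e \<circ> chart_inv d) (at (snd d (F p)))
        (frechet_derivative (snd d \<circ> F \<circ> chart_inv b) (at (snd b p)) (v b))"
    if e: "e \<in> charts_at A (F p)" for e
    using source.change_chart[OF b c differentiable_in_charts[OF p c e], of "v b"]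
      derivative_in_charts[OF p b d target.transition_differentiable[OF d e], of "v b"]
    unfolding vc by simp
  then show ?thesis unfolding diff_map_def coord_vector_def Let_def by (intro ext) simp
qed

lemma diff_map_in_tangent_space:
  assumes p: "p \<in> topspace Y" and v: "v \<in> tangent_space B p"
  shows "diff_map B A F p v \<in> tangent_space A (F p)"
proof -
  obtain d where d: "d \<in> charts_at A (F p)" using target.charts_at_nonempty[OF F_in[OF p]] .
  show ?thesis unfolding diff_map_eq_coord_vector[OF p source.some_chart[OF p] d v]
    by (rule target.coord_vector_in_tangent_space[OF d])
qed

lemma diff_map_linear:
  assumes p: "p \<in> topspace Y"
  shows "diff_map B A F p (u + v) = diff_map B A F p u + diff_map B A F p v"
    "diff_map B A F p (r *\<^sub>R u) = r *\<^sub>R diff_map B A F p u"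
  using linear_frechet_derivative[OF differentiable_in_charts[OF p source.some_chart[OF p]]]
  by (auto simp: diff_map_def Let_def fun_eq_iff scaleR_fun_def linear_add linear_cmul)

text \<open>The chain rule for \<open>f \<circ> F\<close>. When \<open>F\<close> is the inclusion of
  a level set of \<open>f\<close>, the right-hand side is the derivative of a constant.\<close>

lemma diff_function_diff_map:
  assumes p: "p \<in> topspace Y" and f: "smooth_function A f" and v: "v \<in> tangent_space B p"
    and b: "b \<in> charts_at B p"
  shows "diff_function A f (F p) (diff_map B A F p v) =
    frechet_derivative (f \<circ> F \<circ> chart_inv b) (at (snd b p)) (v b)"
proof -
  let ?d = "SOME d. d \<in> charts_at A (F p)"
  have d: "?d \<in> charts_at A (F p)" by (rule target.some_chart[OF F_in[OF p]])
  show ?thesis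
    unfolding diff_function_def Let_def diff_map_eq_coord_vector[OF p b d v]
      target.coord_vector_self[OF d]
    using derivative_in_charts[OF p b d target.smooth_function_differentiable[OF f d]] by simp
qed

text \<open>Near a point one target chart is fixed. The differential sends the coordinate vector of
  \<open>a\<close> to a vector whose components are the derivative, in direction \<open>a\<close>,
  of \<open>F\<close> read in the charts. They depend smoothly on the point, so
  \<open>smooth_tensor_along\<close> applies.\<close>

lemma smooth_symmetric_tensor_pullback:
  assumes h: "smooth_symmetric_tensor X A h"
  shows "smooth_symmetric_tensor Y B (pullback_tensor B A F h)"
  unfolding smooth_symmetric_tensor_def
proof (intro conjI ballI allI)
  fix p assume p: "p \<in> topspace Y"
  have "symmetric_bilinear_on (tangent_space A (F p)) (h (F p))"
    using h F_in[OF p] unfolding smooth_symmetric_tensor_def by blast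
  then show "symmetric_bilinear_on (tangent_space B p) (pullback_tensor B A F h p)"
    unfolding symmetric_bilinear_on_def pullback_tensor_def
    using diff_map_in_tangent_space[OF p] diff_map_linear[OF p] by simp
next
  fix c a a' assume c: "c \<in> B"
  let ?f = "\<lambda>x. pullback_tensor B A F h (chart_inv c x)
    (coord_vector B c (chart_inv c x) a) (coord_vector B c (chart_inv c x) a')"
  show "smooth_on (snd c ` fst c) ?f"
  proof (rule smooth_on_local)
    fix x assume "x \<in> snd c ` fst c"
    then obtain p where p: "p \<in> fst c" "x = snd c p" by blast
    have pY: "p \<in> topspace Y" using p openin_subset[OF source.chart_domain_open[OF c]] by blast
    obtain d where d: "d \<in> charts_at A (F p)" using target.charts_at_nonempty[OF F_in[OF pY]] .
    note dA = target.charts_atD(1)[OF d]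
    let ?P = "{y \<in> topspace Y. F y \<in> fst d}" and ?D = "snd d \<circ> F \<circ> chart_inv c"
    let ?N = "snd c ` (fst c \<inter> ?P)"
    have N: "open ?N" by (rule open_chart_image[OF source.chart[OF c] openin_preimage_chart[OF dA]])
    have xN: "x \<in> ?N" using p pY target.charts_atD(2)[OF d] by auto
    have D: "smooth_on ?N ?D" by (rule smooth_in_charts[OF c dA])
    have F: "F (chart_inv c y) \<in> fst d" if "y \<in> ?N" for y
      using chart_image_elim(2)[OF source.chart[OF c] that] by simp
    have "smooth_on ?N (\<lambda>y. h (F (chart_inv c y))
      (coord_vector A d (F (chart_inv c y)) (frechet_derivative ?D (at y) a))
      (coord_vector A d (F (chart_inv c y)) (frechet_derivative ?D (at y) a')))"
      using D F smooth_on_frechet_derivative[OF D]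
      by (intro target.smooth_tensor_along[OF h dA N]) (simp_all add: o_def)
    then have "smooth_on ?N ?f"
    proof (rule smooth_on_cong[OF N, rotated])
      fix y assume y: "y \<in> ?N"
      let ?q = "chart_inv c y"
      note q = chart_image_elim[OF source.chart[OF c] y]
      have cq: "c \<in> charts_at B ?q" and dq: "d \<in> charts_at A (F ?q)" and qY: "?q \<in> topspace Y"
        using c dA q by (auto simp: charts_at_def)
      have "diff_map B A F ?q (coord_vector B c ?q w) =
          coord_vector A d (F ?q) (frechet_derivative ?D (at y) w)" for w
        using diff_map_eq_coord_vector[OF qY cq dq source.coord_vector_in_tangent_space[OF cq]]
        unfolding source.coord_vector_self[OF cq] q(3) .
      then show "h (F ?q) (coord_vector A d (F ?q) (frechet_derivative ?D (at y) a))
          (coord_vector A d (F ?q) (frechet_derivative ?D (at y) a')) = ?f y"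
        by (simp only: pullback_tensor_def)
    qed
    then show "\<exists>N. open N \<and> x \<in> N \<and> smooth_on N ?f" using N xN by blast
  qed
qed

end


section \<open>The signature-type changing metric\<close>

text \<open>Whichever sign the choice operator takes, it occurs in both factors and cancels.\<close>

lemma signature_changing_metric_eq:
  assumes g: "symmetric_bilinear_on T (g p)" and T: "subspace T"
    and L: "L p = {v, - v}" "v \<in> T" and u: "u \<in> T" "w \<in> T"
  shows "signature_changing_metric g L f p u w = g p u w + f p * (g p v u * g p v w)"
proof -
  interpret bilinear_subspace T "g p" using g T by unfold_locales
  have minus: "g p (- v) x = - g p v x" if "x \<in> T" for x
    using scale_left[OF L(2) that, of "- 1"] by simp
  have "(SOME V. V \<in> L p) \<in> L p" using someI[of "\<lambda>V. V \<in> L p" v] L(1) by simp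
  then have "(SOME V. V \<in> L p) = v \<or> (SOME V. V \<in> L p) = - v" using L(1) by simp
  then show ?thesis
    unfolding signature_changing_metric_def Let_def using minus[OF u(1)] minus[OF u(2)] by auto
qed

section \<open>Smoothness of the signature-type changing metric\<close>

context atlas
begin

lemma smooth_function_along:
  fixes F :: "'a::real_normed_vector \<Rightarrow> 'm"
  assumes f: "smooth_function A f" and c: "c \<in> A" and N: "open N"
    and F: "\<And>x. x \<in> N \<Longrightarrow> F x \<in> fst c" "smooth_on N (\<lambda>x. snd c (F x))"
  shows "smooth_on N (\<lambda>x. f (F x))"
proof -
  have f': "smooth_on (snd c ` fst c) (f \<circ> chart_inv c)"
    using f c unfolding smooth_function_def by blast
  have "(\<lambda>x. snd c (F x)) ` N \<subseteq> snd c ` fst c" using F(1) by blast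
  then have "smooth_on N (\<lambda>x. (f \<circ> chart_inv c) (snd c (F x)))"
    using smooth_on_compose[OF N _ F(2) f'] by blast
  then show ?thesis
    by (rule smooth_on_cong[OF N, rotated]) (simp add: chart_inv_chart[OF chart[OF c] F(1)])
qed

lemma smooth_signature_changing_metric:
  assumes g: "smooth_symmetric_tensor X A g" and L: "smooth_line_element_field X A L"
    and f: "smooth_function A f"
  shows "smooth_symmetric_tensor X A (signature_changing_metric g L f)"
  unfolding smooth_symmetric_tensor_def
proof (intro conjI ballI allI)
  fix p assume p: "p \<in> topspace X"
  note T = subspace_tangent_space[OF p]
  have gp: "symmetric_bilinear_on (tangent_space A p) (g p)"
    using g p unfolding smooth_symmetric_tensor_def by blast
  interpret bilinear_subspace "tangent_space A p" "g p" using T gp by unfold_locales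
  obtain v where v: "v \<in> tangent_space A p" "L p = {v, - v}"
    using L p unfolding smooth_line_element_field_def by blast
  note eq = signature_changing_metric_eq[where f = f and g = g and p = p and L = L, OF gp T v(2,1)]
  show "symmetric_bilinear_on (tangent_space A p) (signature_changing_metric g L f p)"
    unfolding symmetric_bilinear_on_def
    using v(1) T by (simp add: eq subspace_add subspace_scale add_left scale_left add_right
        scale_right algebra_simps) (simp add: sym)
next
  fix c a a' assume c: "c \<in> A"
  let ?e = "\<lambda>x. coord_vector A c (chart_inv c x)"
  let ?h = "\<lambda>x. signature_changing_metric g L f (chart_inv c x) (?e x a) (?e x a')"
  show "smooth_on (snd c ` fst c) ?h"
  proof (rule smooth_on_local)
    fix x assume "x \<in> snd c ` fst c"
    then obtain p where p: "p \<in> fst c" "x = snd c p" by blast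
    then have "p \<in> topspace X" using openin_subset[OF chart_domain_open[OF c]] by blast
    \<comment> \<open>A smooth local representative of the line element replaces the choice made by
      \<open>SOME\<close>, which need not even be continuous.\<close>
    then obtain U V where U: "openin X U" "p \<in> U" and V: "smooth_vector_field_on A U V"
      and LV: "\<forall>x\<in>U. L x = {V x, - V x}"
      using L unfolding smooth_line_element_field_def by metis
    let ?N = "snd c ` (fst c \<inter> U)"
    have N: "open ?N" by (rule open_chart_image[OF chart[OF c] U(1)])
    have xN: "x \<in> ?N" using p U(2) by blast
    have inv: "chart_inv c y \<in> fst c" "chart_inv c y \<in> U" "snd c (chart_inv c y) = y"
      if "y \<in> ?N" for y
      using chart_image_elim[OF chart[OF c] that] by blast+
    have id: "smooth_on ?N (\<lambda>y. snd c (chart_inv c y))"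
      using smooth_on_ident[OF N] by (rule smooth_on_cong[OF N, rotated]) (simp only: inv(3))
    have Vc: "smooth_on ?N (\<lambda>y. V (chart_inv c y) c)"
      using V c unfolding smooth_vector_field_on_def by blast
    note along = smooth_tensor_along[OF g c N inv(1) id]
    have "smooth_on ?N (\<lambda>y. g (chart_inv c y) (?e y a) (?e y a') +
        f (chart_inv c y) * (g (chart_inv c y) (?e y (V (chart_inv c y) c)) (?e y a) *
          g (chart_inv c y) (?e y (V (chart_inv c y) c)) (?e y a')))"
      by (intro smooth_on_add[OF N] smooth_on_mult[OF N] along
          smooth_function_along[OF f c N inv(1) id] smooth_on_const Vc)
    then have "smooth_on ?N ?h"
    proof (rule smooth_on_cong[OF N, rotated])
      fix y assume y: "y \<in> ?N"
      let ?q = "chart_inv c y"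
      have cq: "c \<in> charts_at A ?q" using c inv(1)[OF y] by (simp add: charts_at_def)
      have q: "?q \<in> topspace X" using inv(2)[OF y] openin_subset[OF U(1)] by blast
      have gq: "symmetric_bilinear_on (tangent_space A ?q) (g ?q)"
        using g q unfolding smooth_symmetric_tensor_def by blast
      have Vq: "V ?q \<in> tangent_space A ?q" "L ?q = {V ?q, - V ?q}"
        using V LV inv(2)[OF y] unfolding smooth_vector_field_on_def by blast+
      \<comment> \<open>Written through its components in \<open>c\<close>, the field has the form
        to which \<open>smooth_tensor_along\<close> was applied.\<close>
      have "V ?q = ?e y (V ?q c)" by (rule tangent_vector_eq_coord_vector[OF cq Vq(1)])
      then show "g ?q (?e y a) (?e y a') + f ?q * (g ?q (?e y (V ?q c)) (?e y a) *
          g ?q (?e y (V ?q c)) (?e y a')) = ?h y"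
        using signature_changing_metric_eq[where f = f and g = g and p = ?q and L = L,
            OF gq subspace_tangent_space[OF q] Vq(2,1)
            coord_vector_in_tangent_space[OF cq, of a] coord_vector_in_tangent_space[OF cq, of a']]
        by metis
    qed
    then show "\<exists>N. open N \<and> x \<in> N \<and> smooth_on N ?h" using N xN by blast
  qed
qed

end

text \<open>Taking the very representative that occurs in the definition gives an equality of
  functions, valid also off the tangent space, so the metric at \<open>p\<close> can simply be
  rewritten.\<close>

lemma signature_changing_metric_pointwise:
  fixes X :: "'m topology" and A :: "('m, 'e::euclidean_space) chart set"
  assumes g: "lorentzian_manifold X A g" and L: "smooth_line_element_field X A L"
    and unit: "\<forall>p\<in>topspace X. \<forall>v\<in>L p. g p v v = - 1" and p: "p \<in> topspace X"
  obtains V where "unit_timelike_vector (tangent_space A p) (g p) V (DIM('e) - 1)"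
    "signature_changing_metric g L f p = unit_timelike_vector.change (g p) V (f p)"
proof -
  interpret atlas X A using g unfolding lorentzian_manifold_def by unfold_locales blast
  define V where "V = (SOME V. V \<in> L p)"
  obtain v where v: "v \<in> tangent_space A p" "L p = {v, - v}"
    using L p unfolding smooth_line_element_field_def by blast
  then have "V \<in> L p" unfolding V_def using someI[of "\<lambda>V. V \<in> L p" v] by simp
  moreover have "- v \<in> tangent_space A p"
    using subspace_neg[OF subspace_tangent_space[OF p] v(1)] .
  ultimately have V: "V \<in> tangent_space A p" "g p V V = - 1" using v unit p by auto
  have u: "unit_timelike_vector (tangent_space A p) (g p) V (DIM('e) - 1)"
    using g p V subspace_tangent_space[OF p]
    unfolding lorentzian_manifold_def smooth_symmetric_tensor_def
    by unfold_locales blast+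
  moreover have "signature_changing_metric g L f p = unit_timelike_vector.change (g p) V (f p)"
    unfolding signature_changing_metric_def V_def[symmetric] Let_def
    by (intro ext) (simp add: unit_timelike_vector.change_def[OF u])
  ultimately show thesis by (rule that)
qed

section \<open>The induced metric on a level set\<close>

lemma derivative_const_on_chart:
  assumes c: "is_chart Y c" "p \<in> fst c" and f: "\<And>q. q \<in> fst c \<Longrightarrow> f q = (k::real)"
  shows "frechet_derivative (f \<circ> chart_inv c) (at (snd c p)) w = 0"
proof -
  have "frechet_derivative (\<lambda>x. k) (at (snd c p)) = frechet_derivative (f \<circ> chart_inv c) (at (snd c p))"
  proof (rule frechet_derivative_transform_within_open)
    show "open (snd c ` fst c)" using c(1) unfolding is_chart_def by blast
    show "k = (f \<circ> chart_inv c) x" if "x \<in> snd c ` fst c" for x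
      using that f chart_inv_chart[OF c(1)] by auto
  qed (use c(2) in auto)
  then show ?thesis by (metis frechet_derivative_const)
qed

text \<open>The differential of the inclusion takes values in the kernel of df, because
  \<open>f\<close> is constant on \<open>S\<close>, and it is injective, because \<open>S\<close> is
  embedded; so definiteness on the kernel pulls back.\<close>

lemma pullback_to_level_set_riemannian:
  fixes B :: "('m, 'h::euclidean_space) chart set" and A :: "('m, 'e::euclidean_space) chart set"
  assumes A: "smooth_manifold X A" and h: "smooth_symmetric_tensor X A h"
    and f: "smooth_function A f" and S: "\<And>p. p \<in> S \<Longrightarrow> f p = k"
    and B: "embedded_hypersurface X A S B"
    and pos: "\<And>p. p \<in> S \<Longrightarrow> positive_definite_on (ker_diff A f p) (h p)"
  shows "riemannian_manifold (subtopology X S) B (pullback_tensor B A id h)"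
proof -
  interpret smooth_map_between "subtopology X S" B X A id
    using A B unfolding embedded_hypersurface_def by unfold_locales blast+
  have top: "topspace (subtopology X S) = S"
    using B unfolding embedded_hypersurface_def by auto
  have "positive_definite_on (tangent_space B p) (pullback_tensor B A id h p)" if p: "p \<in> S" for p
    unfolding positive_definite_on_def
  proof (intro ballI impI)
    fix w assume w: "w \<in> tangent_space B p" "w \<noteq> 0"
    have pt: "p \<in> topspace (subtopology X S)" using p top by simp
    let ?w = "diff_map B A id p w"
    obtain b where b: "b \<in> charts_at B p" using source.charts_at_nonempty[OF pt] .
    have bS: "fst b \<subseteq> S"
      using openin_subset[OF source.chart_domain_open[OF source.charts_atD(1)[OF b]]] top by simp
    have "diff_function A f (id p) ?w = 0"
      unfolding diff_function_diff_map[OF pt f w(1) b]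
      using derivative_const_on_chart[OF source.charts_atD(3,2)[OF b], of "f \<circ> id" k] S bS by auto
    then have ker: "?w \<in> ker_diff A f p"
      using diff_map_in_tangent_space[OF pt w(1)] unfolding ker_diff_def by simp
    have "diff_map B A id p 0 = 0" using diff_map_linear(2)[OF pt, of 0 0] by simp
    moreover have "0 \<in> tangent_space B p"
      using source.subspace_tangent_space[OF pt] subspace_0 by blast
    moreover have "inj_on (diff_map B A id p) (tangent_space B p)"
      using B p unfolding embedded_hypersurface_def by blast
    ultimately have "?w \<noteq> 0" using w unfolding inj_on_def by metis
    then show "pullback_tensor B A id h p w w > 0"
      using pos[OF p] ker unfolding positive_definite_on_def pullback_tensor_def by simp
  qed
  then show ?thesis
    unfolding riemannian_manifold_def
    using source.manifold smooth_symmetric_tensor_pullback[OF h] top by simp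
qed

theorem mainTheorem5:
  fixes X :: "'m topology"
    and A :: "('m, 'e::euclidean_space) chart set"
    and g gt :: "('m, 'e) tensor_field"
    and L :: "'m \<Rightarrow> ('m, 'e) tangent_vector set"
    and f :: "'m \<Rightarrow> real"
    and H :: "'m set"
  assumes "DIM('e) \<ge> 2"
    and "lorentzian_manifold X A g"
    and "smooth_line_element_field X A L"
    and "\<forall>p\<in>topspace X. \<forall>v\<in>L p. g p v v = - 1"
    and "smooth_function A f"
    and "regular_value X A f 1"
    and "gt = signature_changing_metric g L f"
    and "H = degeneracy_locus X A gt"
  shows "H = {p \<in> topspace X. f p = 1} \<and>
    (\<forall>q\<in>H. \<not> radical_on (tangent_space A q) (gt q) \<subseteq> ker_diff A f q \<longrightarrow>
        positive_definite_on (ker_diff A f q) (gt q)) \<and>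
    ((\<forall>q\<in>H. transverse_in (tangent_space A q)
                (radical_on (tangent_space A q) (gt q)) (ker_diff A f q)) \<longrightarrow>
        (\<forall>B :: ('m, 'h::euclidean_space) chart set. embedded_hypersurface X A H B \<longrightarrow>
            riemannian_manifold (subtopology X H) B (pullback_tensor B A id gt))) \<and>
    (\<forall>q\<in>H. radical_on (tangent_space A q) (gt q) \<subseteq> ker_diff A f q \<longrightarrow>
        degenerate_on (ker_diff A f q) (gt q) \<and>
        positive_semidefinite_on (ker_diff A f q) (gt q) \<and>
        has_signature (ker_diff A f q) (gt q) 1 0 (DIM('e) - 2))"
proof -
  note f = assms(5)
  have M: "smooth_manifold X A" and gs: "smooth_symmetric_tensor X A g"
    using assms(2) unfolding lorentzian_manifold_def by blast+
  interpret atlas X A using M by unfold_locales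
  note pointwise = signature_changing_metric_pointwise[OF assms(2,3,4), of _ f, folded assms(7)]
  have "degenerate_on (tangent_space A p) (gt p) \<longleftrightarrow> f p = 1" if p: "p \<in> topspace X" for p
  proof -
    obtain V where V: "unit_timelike_vector (tangent_space A p) (g p) V (DIM('e) - 1)"
      "gt p = unit_timelike_vector.change (g p) V (f p)" using pointwise[OF p] .
    show ?thesis unfolding V(2) by (rule unit_timelike_vector.degenerate_change_iff[OF V(1)])
  qed
  then have H: "H = {p \<in> topspace X. f p = 1}" unfolding assms(8) degeneracy_locus_def by blast
  have ker_sub: "ker_diff A f q \<subseteq> tangent_space A q" for q unfolding ker_diff_def by blast
  \<comment> \<open>Regularity gives a preimage of 1 under the differential, which is therefore
    nonzero.\<close>
  have surj: "\<exists>z\<in>tangent_space A q. diff_function A f q z \<noteq> 0" if "q \<in> H" for q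
  proof -
    have "1 \<in> diff_function A f q ` tangent_space A q"
      using assms(6) that unfolding regular_value_def H by simp
    then show ?thesis by force
  qed
  have transverse: "positive_definite_on (ker_diff A f q) (gt q)"
    if q: "q \<in> H" and rad: "\<not> radical_on (tangent_space A q) (gt q) \<subseteq> ker_diff A f q" for q
  proof -
    have qX: "q \<in> topspace X" and fq: "f q = 1" using q H by auto
    obtain V where V: "unit_timelike_vector (tangent_space A q) (g q) V (DIM('e) - 1)"
      "gt q = unit_timelike_vector.change (g q) V 1" using pointwise[OF qX] unfolding fq .
    show ?thesis
      using unit_timelike_vector.positive_definite_of_transverse_radical[OF V(1)
          subspace_ker_diff[OF f qX] ker_sub] rad
      unfolding V(2) by blast
  qed
  have tangent: "degenerate_on (ker_diff A f q) (gt q) \<and>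
      positive_semidefinite_on (ker_diff A f q) (gt q) \<and>
      has_signature (ker_diff A f q) (gt q) 1 0 (DIM('e) - 2)"
    if q: "q \<in> H" and rad: "radical_on (tangent_space A q) (gt q) \<subseteq> ker_diff A f q" for q
  proof -
    have qX: "q \<in> topspace X" and fq: "f q = 1" using q H by auto
    obtain V where V: "unit_timelike_vector (tangent_space A q) (g q) V (DIM('e) - 1)"
      "gt q = unit_timelike_vector.change (g q) V 1" using pointwise[OF qX] unfolding fq .
    interpret unit_timelike_vector "tangent_space A q" "g q" V "DIM('e) - 1" by (rule V(1))
    obtain z where z: "z \<in> tangent_space A q" "diff_function A f q z \<noteq> 0" using surj[OF q] by blast
    have "V \<in> ker_diff A f q" using rad radical_change_1 span_base[of V "{V}"] unfolding V(2) by blast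
    then have "diff_function A f q V = 0" unfolding ker_diff_def by blast
    note * = hyperplane_through_radical[of "diff_function A f q",
        OF diff_function_linear[OF f qX] z this ker_diff_def]
    \<comment> \<open>\<open>g\<close> has n - 1 plus signs, the value of \<open>l\<close> here; the
      hyperplane carries one fewer.\<close>
    have "DIM('e) - 1 - 1 = DIM('e) - 2" by simp
    then show ?thesis using * unfolding V(2) by metis
  qed
  have "riemannian_manifold (subtopology X H) B (pullback_tensor B A id gt)"
    if tr: "\<forall>q\<in>H. transverse_in (tangent_space A q)
        (radical_on (tangent_space A q) (gt q)) (ker_diff A f q)"
      and B: "embedded_hypersurface X A H B" for B :: "('m, 'h) chart set"
  proof (rule pullback_to_level_set_riemannian[OF M _ f _ B])
    show "smooth_symmetric_tensor X A gt"
      unfolding assms(7) by (rule smooth_signature_changing_metric[OF gs assms(3) f])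
    show "f p = 1" if "p \<in> H" for p using that H by blast
    fix q assume q: "q \<in> H"
    have qX: "q \<in> topspace X" using q H by blast
    show "positive_definite_on (ker_diff A f q) (gt q)"
    proof (rule transverse[OF q])
      \<comment> \<open>Were the radical inside the kernel, the sum of the two would stay in the
        kernel and, by transversality, fill the tangent space, against the nonzero
        differential.\<close>
      show "\<not> radical_on (tangent_space A q) (gt q) \<subseteq> ker_diff A f q"
      proof
        assume rad: "radical_on (tangent_space A q) (gt q) \<subseteq> ker_diff A f q"
        have "tangent_space A q =
            {u + w | u w. u \<in> radical_on (tangent_space A q) (gt q) \<and> w \<in> ker_diff A f q}"
          using bspec[OF tr q] unfolding transverse_in_def by (rule sym)
        also have "\<dots> \<subseteq> ker_diff A f q"
        proof clarify
          fix u w assume "u \<in> radical_on (tangent_space A q) (gt q)" and w: "w \<in> ker_diff A f q"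
          then have "u \<in> ker_diff A f q" using subsetD[OF rad] by simp
          then show "u + w \<in> ker_diff A f q" using w by (rule subspace_add[OF subspace_ker_diff[OF f qX]])
        qed
        finally have "tangent_space A q \<subseteq> ker_diff A f q" .
        then show False using surj[OF q] unfolding ker_diff_def by blast
      qed
    qed
  qed
  with H transverse tangent show ?thesis by blast
qed

end
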